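(* Let $\alpha>0$, let $f$ be a nonnegative differentiable function whose derivative $f'$ is regularly varying at $\infty$ of index $\alpha-1$, and let $B=(B(u))_{u\ge0}$ be a standard Brownian motion. Then $$C\left(\left(\frac{\int_0^t B(t-x)f'(x)\,\mathrm dx}{\bigl(2(2\alpha+1)^{-1}t\log\log t\bigr)^{1/2}f(t)}:\ t>\max(\mathrm e,t_0)\right)\right)=[-1,1]\quad\text{almost surely,}$$ where $t_0>0$ is any fixed value such that $f(t)>0$ for all $t\ge t_0$.
   Context: Here $f$ is a function of a nonnegative real variable. For a family $(x_t)$ of real numbers, $C((x_t))$ denotes the set of its limit points (as the index $t$ tends to $\infty$). A measurable function $g$, positive on a neighbourhood of $\infty$, is regularly varying at $\infty$ of index $\rho\in\mathbb R$ if $\lim_{t\to\infty}g(\lambda t)/g(t)=\lambda^\rho$ for all $\lambda>0$. *)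

theory Defs
  imports "HOL-Probability.Probability"
begin

text \<open>Regular variation for functions of a nonnegative real variable; the values of \<open>g\<close> on the
  negative half-line are irrelevant.\<close>

definition regularly_varying :: "(real \<Rightarrow> real) \<Rightarrow> real \<Rightarrow> bool" where
  "regularly_varying g \<rho> \<longleftrightarrow>
     set_borel_measurable borel {0..} g \<and>
     (\<forall>\<^sub>F t in at_top. g t > 0) \<and>
     (\<forall>c>0. ((\<lambda>t. g (c * t) / g t) \<longlongrightarrow> c powr \<rho>) at_top)"

text \<open>Limit points, as the index tends to infinity, of a family \<open>(x t)\<close> indexed by \<open>t \<in> I\<close>: the
  real limits along sequences of indices tending to infinity.\<close>

definition limit_points :: "real set \<Rightarrow> (real \<Rightarrow> real) \<Rightarrow> real set" where
  "limit_points I x =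
     {y. \<exists>s :: nat \<Rightarrow> real. range s \<subseteq> I \<and> filterlim s at_top sequentially \<and>
           (\<lambda>n. x (s n)) \<longlonglongrightarrow> y}"

text \<open>The time set is the half-line \<open>u \<ge> 0\<close>; nothing is assumed about \<open>B u\<close> for \<open>u < 0\<close>. The second
  parameter of \<open>normal_density\<close> is the standard deviation, not the variance.\<close>

locale standard_brownian_motion = prob_space M for M :: "'a measure" +
  fixes B :: "real \<Rightarrow> 'a \<Rightarrow> real"
  assumes borel_measurable_values: "\<And>u. 0 \<le> u \<Longrightarrow> B u \<in> borel_measurable M"
    and start_zero: "AE \<omega> in M. B 0 \<omega> = 0"
    and independent_increments:
      "\<And>(s :: nat \<Rightarrow> real) n. 0 \<le> s 0 \<Longrightarrow> (\<And>i. i < n \<Longrightarrow> s i \<le> s (Suc i)) \<Longrightarrow>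
         indep_vars (\<lambda>_. borel) (\<lambda>i \<omega>. B (s (Suc i)) \<omega> - B (s i) \<omega>) {..<n}"
    and gaussian_increments:
      "\<And>s t. 0 \<le> s \<Longrightarrow> s < t \<Longrightarrow>
         distributed M lborel (\<lambda>\<omega>. B t \<omega> - B s \<omega>) (normal_density 0 (sqrt (t - s)))"
    and continuous_paths: "AE \<omega> in M. continuous_on {0..} (\<lambda>u. B u \<omega>)"

end

theory Submission
  imports Defs "HOL-Real_Asymp.Real_Asymp"
begin

text \<open>After division by \<open>f t\<close>, the convolution integral averages the path \<open>u \<mapsto> B (t * u)\<close> on the unit
  interval against a measure with distribution function \<open>f (t * y) / f t \<longlonglongrightarrow> y powr \<alpha>\<close> (l'Hopital's
  rule). On the scale \<open>sqrt (2 * t * ln (ln t))\<close> the paths are almost surely asymptotically equicontinuous, by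
  dyadic chaining and a single Borel--Cantelli argument. Hence the integral is uniformly close to a
  finite weighted sum of \<open>n\<close> increments of \<open>B\<close>, a Gaussian variable of variance \<open>t\<close> times a Riemann
  sum of the integral of \<open>y powr (2 * \<alpha>)\<close>. For such sums the law of the iterated logarithm is
  classical: the first Borel--Cantelli lemma along the powers of \<open>1 + 1 / n\<close> gives the upper bound, and the
  second one along the powers of \<open>n\<close>, where all increments but the first are independent of the
  past, shows that both extreme values are approached. Intermediate values are attained by
  continuity of the weighted sum in \<open>t\<close>.\<close>

subsection \<open>Gaussian tails and the second Borel--Cantelli lemma\<close>

text \<open>The order of the limits shapes the proof: \<open>n\<close> is fixed, \<open>t\<close>
  tends to infinity, and only then does \<open>n\<close> grow. For fixed \<open>n\<close>, the
  convergence of \<open>f (t * y) / f t\<close> is used at the finitely many points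
  \<open>j / n\<close>. Equicontinuity serves four times: it freezes the path on each grid cell,
  bounds it on the whole of \<open>{0..t}\<close>, bridges the gaps between consecutive powers of
  \<open>1 + 1 / n\<close>, and makes the first increment, over an interval of relative length
  \<open>1 / n\<close>, negligible. What remains for probability are sequences of one-dimensional
  Gaussian variables. One obstacle is that \<open>f'\<close> is positive only near infinity; its
  absolute integral over the initial stretch is a constant, absorbed because \<open>f\<close> tends
  to infinity. The factor \<open>3 / 4\<close> in the chaining exceeds \<open>1 / sqrt 2\<close>,
  the rate at which the standard deviation of a dyadic increment decays per level, and is below 1,
  so that both the tails and the chain sums converge. All probability is collected in
  \<open>lil_path\<close>; the remaining arguments concern a single path.\<close>

text \<open>For \<open>u > x\<close> the inequality
  \<open>x\<^sup>2 + (u - x)\<^sup>2 \<le> u\<^sup>2\<close> bounds the density by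
  \<open>exp (- x\<^sup>2 / (2 * \<sigma>\<^sup>2))\<close> times the density centred at
  \<open>x\<close>, whose mass is 1.\<close>

lemma (in prob_space) normal_tail_upper:
  assumes X: "distributed M lborel X (normal_density 0 \<sigma>)" and "0 < \<sigma>" "0 \<le> x"
  shows "prob {\<omega> \<in> space M. X \<omega> > x} \<le> exp (- x\<^sup>2 / (2 * \<sigma>\<^sup>2))"
proof -
  have dens: "normal_density 0 \<sigma> u \<le> exp (- x\<^sup>2 / (2 * \<sigma>\<^sup>2)) * normal_density x \<sigma> u" if "u > x" for u
  proof -
    have "0 \<le> x * (u - x)"
      using that assms by simp
    then have "x\<^sup>2 + (u - x)\<^sup>2 \<le> u\<^sup>2"
      by (simp add: power2_eq_square algebra_simps)
    then have "- u\<^sup>2 / (2 * \<sigma>\<^sup>2) \<le> (- x\<^sup>2 - (u - x)\<^sup>2) / (2 * \<sigma>\<^sup>2)"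
      by (intro divide_right_mono) auto
    then have "- u\<^sup>2 / (2 * \<sigma>\<^sup>2) \<le> - x\<^sup>2 / (2 * \<sigma>\<^sup>2) + - (u - x)\<^sup>2 / (2 * \<sigma>\<^sup>2)"
      by (simp add: diff_divide_distrib)
    then have "exp (- u\<^sup>2 / (2 * \<sigma>\<^sup>2)) \<le> exp (- x\<^sup>2 / (2 * \<sigma>\<^sup>2)) * exp (- (u - x)\<^sup>2 / (2 * \<sigma>\<^sup>2))"
      by (simp flip: exp_add)
    then have "1 / sqrt (2 * pi * \<sigma>\<^sup>2) * exp (- u\<^sup>2 / (2 * \<sigma>\<^sup>2))
        \<le> 1 / sqrt (2 * pi * \<sigma>\<^sup>2) * (exp (- x\<^sup>2 / (2 * \<sigma>\<^sup>2)) * exp (- (u - x)\<^sup>2 / (2 * \<sigma>\<^sup>2)))"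
      by (intro mult_left_mono) auto
    then show ?thesis
      by (simp add: normal_density_def mult_ac)
  qed
  have "emeasure M (X -` {x<..} \<inter> space M) = (\<integral>\<^sup>+u. ennreal (normal_density 0 \<sigma> u) * indicator {x<..} u \<partial>lborel)"
    by (rule distributed_emeasure[OF X]) simp
  also have "\<dots> \<le> (\<integral>\<^sup>+u. ennreal (exp (- x\<^sup>2 / (2 * \<sigma>\<^sup>2)) * normal_density x \<sigma> u) \<partial>lborel)"
    by (intro nn_integral_mono) (use dens in \<open>auto simp: ennreal_leI split: split_indicator\<close>)
  also have "\<dots> = ennreal (exp (- x\<^sup>2 / (2 * \<sigma>\<^sup>2)))"
    using assms by (subst nn_integral_eq_integral) auto
  finally have "prob (X -` {x<..} \<inter> space M) \<le> exp (- x\<^sup>2 / (2 * \<sigma>\<^sup>2))"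
    by (simp add: emeasure_eq_measure)
  also have "X -` {x<..} \<inter> space M = {\<omega> \<in> space M. X \<omega> > x}"
    by auto
  finally show ?thesis .
qed

lemma (in prob_space) normal_abs_tail_upper:
  assumes X: "distributed M lborel X (normal_density 0 \<sigma>)" and "0 < \<sigma>" "0 \<le> x"
  shows "prob {\<omega> \<in> space M. \<bar>X \<omega>\<bar> > x} \<le> 2 * exp (- (x\<^sup>2 / (2 * \<sigma>\<^sup>2)))"
proof -
  have X': "distributed M lborel (\<lambda>\<omega>. - X \<omega>) (normal_density 0 \<sigma>)"
    using normal_density_affine[OF X, of "-1" 0] assms by simp
  have [measurable]: "X \<in> borel_measurable M"
    using distributed_measurable[OF X] by simp
  have "{\<omega> \<in> space M. \<bar>X \<omega>\<bar> > x} = {\<omega> \<in> space M. X \<omega> > x} \<union> {\<omega> \<in> space M. - X \<omega> > x}"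
    by auto
  then have "prob {\<omega> \<in> space M. \<bar>X \<omega>\<bar> > x}
      \<le> prob {\<omega> \<in> space M. X \<omega> > x} + prob {\<omega> \<in> space M. - X \<omega> > x}"
    by (simp add: measure_Un_le)
  with normal_tail_upper[OF X] normal_tail_upper[OF X'] assms show ?thesis
    by fastforce
qed

text \<open>On the interval from \<open>\<sigma> * x\<close> to \<open>\<sigma> * (x + 1)\<close>
  the density is at least its value at the right end. The crude shift from \<open>x\<close> to
  \<open>x + 1\<close> is later offset by lowering the threshold by 1.\<close>

lemma (in prob_space) normal_tail_lower:
  assumes X: "distributed M lborel X (normal_density 0 \<sigma>)" and "0 < \<sigma>" "0 \<le> x"
  shows "exp (- (x + 1)\<^sup>2 / 2) / sqrt (2 * pi) \<le> prob {\<omega> \<in> space M. X \<omega> > \<sigma> * x}"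
proof -
  define c where "c = exp (- (x + 1)\<^sup>2 / 2) / sqrt (2 * pi) / \<sigma>"
  have "0 \<le> c"
    using assms by (simp add: c_def)
  have dens: "c \<le> normal_density 0 \<sigma> u" if "u > \<sigma> * x" "u < \<sigma> * (x + 1)" for u
  proof -
    have "0 \<le> \<sigma> * x"
      using assms by simp
    then have "u\<^sup>2 \<le> (\<sigma> * (x + 1))\<^sup>2"
      using that by (intro power_mono) auto
    then have "u\<^sup>2 / (2 * \<sigma>\<^sup>2) \<le> (x + 1)\<^sup>2 / 2"
      using assms by (simp add: pos_divide_le_eq power_mult_distrib mult.commute)
    then have "exp (- (x + 1)\<^sup>2 / 2) \<le> exp (- u\<^sup>2 / (2 * \<sigma>\<^sup>2))"
      by simp
    moreover have "sqrt (2 * pi * \<sigma>\<^sup>2) = sqrt (2 * pi) * \<sigma>"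
      using assms by (simp add: real_sqrt_mult)
    ultimately show ?thesis
      using assms by (simp add: c_def normal_density_def divide_right_mono)
  qed
  have "ennreal (exp (- (x + 1)\<^sup>2 / 2) / sqrt (2 * pi)) = ennreal c * ennreal (\<sigma> * (x + 1) - \<sigma> * x)"
    using assms \<open>0 \<le> c\<close> by (subst ennreal_mult[symmetric]) (auto simp: algebra_simps c_def)
  also have "\<dots> = (\<integral>\<^sup>+u. ennreal c * indicator {\<sigma> * x<..<\<sigma> * (x + 1)} u \<partial>lborel)"
    using assms by (subst nn_integral_cmult_indicator) (auto simp: algebra_simps)
  also have "\<dots> \<le> (\<integral>\<^sup>+u. ennreal (normal_density 0 \<sigma> u) * indicator {\<sigma> * x<..} u \<partial>lborel)"
    by (intro nn_integral_mono) (use dens in \<open>auto simp: ennreal_leI split: split_indicator\<close>)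
  also have "\<dots> = emeasure M (X -` {\<sigma> * x<..} \<inter> space M)"
    by (rule distributed_emeasure[OF X, symmetric]) simp
  finally have "exp (- (x + 1)\<^sup>2 / 2) / sqrt (2 * pi) \<le> prob (X -` {\<sigma> * x<..} \<inter> space M)"
    by (simp add: emeasure_eq_measure)
  also have "X -` {\<sigma> * x<..} \<inter> space M = {\<omega> \<in> space M. X \<omega> > \<sigma> * x}"
    by auto
  finally show ?thesis .
qed

text \<open>Independence and \<open>1 - p \<le> exp (- p)\<close> bound the probability of no
  success from \<open>m\<close> on by \<open>exp\<close> of minus a partial sum, and these sums are
  unbounded. Real variables and finite index sets \<open>{..<N}\<close> match the form in which
  Brownian increments are independent.\<close>

lemma (in prob_space) borel_cantelli_AE2:
  fixes X :: "nat \<Rightarrow> 'a \<Rightarrow> real"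
  assumes ind: "\<And>N. indep_vars (\<lambda>_. borel) X {..<N}"
    and div: "\<not> summable (\<lambda>k. prob {\<omega> \<in> space M. X k \<omega> > x k})"
  shows "AE \<omega> in M. \<exists>\<^sub>F k in sequentially. X k \<omega> > x k"
proof -
  let ?p = "\<lambda>k. prob {\<omega> \<in> space M. X k \<omega> > x k}"
  have [measurable]: "X k \<in> borel_measurable M" for k
    using ind[of "Suc k"] by (auto simp: indep_vars_def)
  have zero: "prob {\<omega> \<in> space M. \<forall>k\<ge>m. X k \<omega> \<le> x k} = 0" for m
  proof -
    have bound: "prob {\<omega> \<in> space M. \<forall>k\<ge>m. X k \<omega> \<le> x k} \<le> exp (- (\<Sum>k=m..<m + Suc N. ?p k))" for N
    proof -
      let ?J = "{m..<m + Suc N}"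
      have "prob {\<omega> \<in> space M. \<forall>k\<ge>m. X k \<omega> \<le> x k} \<le> prob (\<Inter>k\<in>?J. X k -` {..x k} \<inter> space M)"
        by (intro finite_measure_mono) auto
      also have "\<dots> = (\<Prod>k\<in>?J. prob (X k -` {..x k} \<inter> space M))"
        by (rule indep_varsD[OF ind[of "m + Suc N"]]) auto
      also have "\<dots> = (\<Prod>k\<in>?J. 1 - ?p k)"
      proof (rule prod.cong[OF refl])
        fix k
        have "X k -` {..x k} \<inter> space M = space M - {\<omega> \<in> space M. X k \<omega> > x k}"
          by auto
        then show "prob (X k -` {..x k} \<inter> space M) = 1 - ?p k"
          by (simp add: prob_compl)
      qed
      also have "\<dots> \<le> (\<Prod>k\<in>?J. exp (- ?p k))"
      proof (rule prod_mono)
        fix k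
        show "0 \<le> 1 - ?p k \<and> 1 - ?p k \<le> exp (- ?p k)"
          using exp_ge_add_one_self[of "- ?p k"] by simp
      qed
      also have "\<dots> = exp (- (\<Sum>k\<in>?J. ?p k))"
        by (simp add: exp_sum del: prod.op_ivl_Suc sum.op_ivl_Suc flip: sum_negf)
      finally show ?thesis .
    qed
    have "\<not> summable (\<lambda>k. ?p (k + m))"
      using div by (subst summable_iff_shift)
    then have unb: "\<exists>N. (\<Sum>k<N. ?p (k + m)) > C" for C
      using summableI_nonneg_bounded[of "\<lambda>k. ?p (k + m)" C] by (auto simp: not_le[symmetric])
    have "prob {\<omega> \<in> space M. \<forall>k\<ge>m. X k \<omega> \<le> x k} \<le> e" if "e > 0" for e
    proof -
      obtain N where N: "(\<Sum>k<N. ?p (k + m)) > - ln e"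
        using unb by blast
      have "(\<Sum>k<N. ?p (k + m)) \<le> (\<Sum>k<Suc N. ?p (k + m))"
        by simp
      also have "\<dots> = (\<Sum>k=m..<m + Suc N. ?p k)"
        using sum.shift_bounds_nat_ivl[of ?p 0 m "Suc N"]
        by (simp add: atLeast0LessThan add.commute del: sum.lessThan_Suc)
      finally have "exp (- (\<Sum>k=m..<m + Suc N. ?p k)) \<le> exp (ln e)"
        using N by simp
      with bound[of N] that show ?thesis
        by simp
    qed
    then have "prob {\<omega> \<in> space M. \<forall>k\<ge>m. X k \<omega> \<le> x k} \<le> 0"
      by (meson dense_le dense_ge)
    then show ?thesis
      by (simp add: measure_le_0_iff)
  qed
  have "AE \<omega> in M. \<not> (\<forall>k\<ge>m. X k \<omega> \<le> x k)" for m
  proof (rule AE_I[where N="{\<omega> \<in> space M. \<forall>k\<ge>m. X k \<omega> \<le> x k}"])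
    show "emeasure M {\<omega> \<in> space M. \<forall>k\<ge>m. X k \<omega> \<le> x k} = 0"
      using zero[of m] by (simp add: emeasure_eq_measure)
  qed auto
  then have "AE \<omega> in M. \<forall>m. \<not> (\<forall>k\<ge>m. X k \<omega> \<le> x k)"
    by (simp add: AE_all_countable)
  then show ?thesis
    by eventually_elim (auto simp: frequently_sequentially not_le)
qed

text \<open>Strictly increasing times and nonzero weights keep every summand nondegenerate, so that
  each has a normal density.\<close>

lemma (in standard_brownian_motion) weighted_increments_normal:
  fixes s c :: "nat \<Rightarrow> real"
  assumes "0 \<le> s 0" "\<And>i. i < n \<Longrightarrow> s i < s (Suc i)" "\<And>i. i < n \<Longrightarrow> c i \<noteq> 0" "0 < n"
  shows "distributed M lborel (\<lambda>\<omega>. \<Sum>i<n. c i * (B (s (Suc i)) \<omega> - B (s i) \<omega>))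
    (normal_density 0 (sqrt (\<Sum>i<n. (c i)\<^sup>2 * (s (Suc i) - s i))))"
proof -
  have s_nonneg: "0 \<le> s i" if "i \<le> n" for i
    using that
  proof (induction i)
    case (Suc i)
    then show ?case
      using assms(2)[of i] by simp
  qed (use assms in simp)
  have "indep_vars (\<lambda>_. borel) (\<lambda>i \<omega>. B (s (Suc i)) \<omega> - B (s i) \<omega>) {..<n}"
    using assms less_imp_le by (intro independent_increments) auto
  then have "indep_vars (\<lambda>_. borel) (\<lambda>i \<omega>. c i * (B (s (Suc i)) \<omega> - B (s i) \<omega>)) {..<n}"
    by (rule indep_vars_compose2) simp
  moreover have "distributed M lborel (\<lambda>\<omega>. c i * (B (s (Suc i)) \<omega> - B (s i) \<omega>))
      (normal_density 0 (\<bar>c i\<bar> * sqrt (s (Suc i) - s i)))" if "i < n" for i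
    using normal_density_affine[OF gaussian_increments[of "s i" "s (Suc i)"], of "c i" 0]
      s_nonneg[of i] assms that by simp
  ultimately have "distributed M lborel (\<lambda>\<omega>. \<Sum>i<n. c i * (B (s (Suc i)) \<omega> - B (s i) \<omega>))
    (normal_density (\<Sum>i<n. 0) (sqrt (\<Sum>i<n. (\<bar>c i\<bar> * sqrt (s (Suc i) - s i))\<^sup>2)))"
    using assms by (intro sum_indep_normal) auto
  also have "(\<Sum>i<n. (\<bar>c i\<bar> * sqrt (s (Suc i) - s i))\<^sup>2) = (\<Sum>i<n. (c i)\<^sup>2 * (s (Suc i) - s i))"
    using assms(2) by (intro sum.cong) (auto simp: power_mult_distrib less_imp_le)
  finally show ?thesis
    by simp
qed

subsection \<open>Modulus of continuity on the scale of the iterated logarithm\<close>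

definition lil_scale :: "real \<Rightarrow> real" where
  "lil_scale t = sqrt (2 * t * ln (ln t))"

text \<open>Successive binary truncations of \<open>x\<close> coincide or differ by one cell of the
  finer grid, so the way from level \<open>m\<close> to \<open>x\<close> costs at most the tail of
  the geometric series of \<open>(3/4) ^ j\<close>, which is \<open>3 * (3/4) ^ m\<close>.\<close>

lemma dyadic_chaining_point:
  fixes g :: "real \<Rightarrow> real"
  assumes cont: "continuous_on {0..1} g" and "0 \<le> s" "J \<le> m" "0 \<le> x" "x \<le> 1"
    and step: "\<And>j i. J \<le> j \<Longrightarrow> i < 2 ^ j \<Longrightarrow> \<bar>g ((real i + 1) / 2 ^ j) - g (real i / 2 ^ j)\<bar> \<le> (3/4) ^ j * s"
  shows "\<bar>g x - g (real (nat \<lfloor>x * 2 ^ m\<rfloor>) / 2 ^ m)\<bar> \<le> 3 * (3/4) ^ m * s"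
proof -
  define d where "d j = nat \<lfloor>x * 2 ^ j\<rfloor>" for j
  define z where "z j = real (d j) / 2 ^ j" for j
  have d: "real (d j) \<le> x * 2 ^ j" "x * 2 ^ j < real (d j) + 1" for j
    using \<open>0 \<le> x\<close> by (simp_all add: d_def)
  have d_Suc: "d (Suc j) = 2 * d j \<or> d (Suc j) = Suc (2 * d j)" for j
  proof -
    have "real (d (Suc j)) < 2 * real (d j) + 2" "2 * real (d j) < real (d (Suc j)) + 1"
      using d[of j] d[of "Suc j"] by simp_all
    then show ?thesis
      by linarith
  qed
  have one_step: "\<bar>g (z (Suc j)) - g (z j)\<bar> \<le> (3/4) ^ Suc j * s" if "J \<le> j" for j
    using d_Suc[of j]
  proof
    assume "d (Suc j) = 2 * d j"
    then show ?thesis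
      using \<open>0 \<le> s\<close> by (simp add: z_def)
  next
    assume e: "d (Suc j) = Suc (2 * d j)"
    have "real (d (Suc j)) \<le> 1 * 2 ^ Suc j"
      using d(1) by (rule order_trans) (intro mult_right_mono \<open>x \<le> 1\<close>; simp)
    then have "real (Suc (2 * d j)) \<le> real (2 ^ Suc j)"
      by (simp only: e of_nat_power of_nat_numeral mult_1)
    then have "2 * d j < 2 ^ Suc j"
      by (simp only: of_nat_le_iff Suc_le_eq)
    from step[OF _ this] e that show ?thesis
      by (simp add: z_def add.commute)
  qed
  \<comment> \<open>The exact partial sum of the geometric series closes the induction; the bare
    bound \<open>3 * (3/4) ^ m * s\<close> would not.\<close>
  have "\<bar>g (z (m + p)) - g (z m)\<bar> \<le> 3 * (3/4) ^ m * s * (1 - (3/4) ^ p)" for p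
  proof (induction p)
    case (Suc p)
    have "\<bar>g (z (Suc (m + p))) - g (z m)\<bar> \<le> (3/4) ^ Suc (m + p) * s + 3 * (3/4) ^ m * s * (1 - (3/4) ^ p)"
      using Suc one_step[of "m + p"] \<open>J \<le> m\<close> by linarith
    also have "\<dots> = 3 * (3/4) ^ m * s * (1 - (3/4) ^ Suc p)"
      by (simp add: power_add algebra_simps)
    finally show ?case
      by simp
  qed simp
  moreover have "3 * (3/4) ^ m * s * (1 - (3/4) ^ p) \<le> 3 * (3/4) ^ m * s" for p
    using \<open>0 \<le> s\<close> by (intro mult_left_le) auto
  ultimately have bound: "\<bar>g (z (m + p)) - g (z m)\<bar> \<le> 3 * (3/4) ^ m * s" for p
    using order_trans by blast
  have z01: "z j \<in> {0..1}" for j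
  proof -
    have "real (d j) \<le> 1 * 2 ^ j"
      using d(1) by (rule order_trans) (intro mult_right_mono \<open>x \<le> 1\<close>; simp)
    then show ?thesis
      by (simp add: z_def)
  qed
  have "z \<longlonglongrightarrow> x"
  proof (rule tendsto_sandwich)
    show "\<forall>\<^sub>F j in sequentially. x - (1/2) ^ j \<le> z j"
    proof (intro always_eventually allI)
      fix j
      have "x \<le> (real (d j) + 1) / 2 ^ j"
        using d(2)[of j] by (simp add: pos_le_divide_eq less_imp_le)
      then show "x - (1/2) ^ j \<le> z j"
        by (simp add: z_def add_divide_distrib power_divide)
    qed
    show "\<forall>\<^sub>F j in sequentially. z j \<le> x"
      using d(1) by (auto simp: z_def field_simps)
    show "(\<lambda>j. x - (1/2) ^ j) \<longlonglongrightarrow> x"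
      by real_asymp
  qed simp
  then have "(\<lambda>p. z (m + p)) \<longlonglongrightarrow> x"
    using LIMSEQ_ignore_initial_segment[of z x m] by (simp add: add.commute)
  with cont have "(\<lambda>p. g (z (m + p))) \<longlonglongrightarrow> g x"
    using z01 assms by (auto simp: continuous_on_sequentially comp_def)
  then have "(\<lambda>p. \<bar>g (z (m + p)) - g (z m)\<bar>) \<longlonglongrightarrow> \<bar>g x - g (z m)\<bar>"
    by (intro tendsto_intros)
  then show ?thesis
    using bound by (intro LIMSEQ_le_const2[of _ _ "3 * (3/4) ^ m * s"]) (auto simp: z_def d_def)
qed

text \<open>The level-\<open>m\<close> truncations of two such points are equal or adjacent, which
  costs at most one step; each descent to the point itself costs three:
  \<open>7 = 3 + 1 + 3\<close>.\<close>

lemma dyadic_chaining: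
  fixes g :: "real \<Rightarrow> real"
  assumes cont: "continuous_on {0..1} g" and "0 \<le> s" "J \<le> m"
    and step: "\<And>j i. J \<le> j \<Longrightarrow> i < 2 ^ j \<Longrightarrow> \<bar>g ((real i + 1) / 2 ^ j) - g (real i / 2 ^ j)\<bar> \<le> (3/4) ^ j * s"
    and "x \<in> {0..1}" "y \<in> {0..1}" "\<bar>x - y\<bar> \<le> 1 / 2 ^ m"
  shows "\<bar>g x - g y\<bar> \<le> 7 * (3/4) ^ m * s"
  using assms(5-7)
proof (induction x y rule: linorder_wlog)
  case (le x y)
  define d where "d z = nat \<lfloor>z * 2 ^ m\<rfloor>" for z :: real
  have d: "real (d z) \<le> z * 2 ^ m" "z * 2 ^ m < real (d z) + 1" if "0 \<le> z" for z
    using that by (simp_all add: d_def)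
  have "(y - x) * 2 ^ m \<le> 1" "x * 2 ^ m \<le> y * 2 ^ m"
    using le by (simp_all add: field_simps)
  then have "real (d y) < real (d x) + 2" "real (d x) < real (d y) + 1"
    using d[of x] d[of y] le by (simp_all only: left_diff_distrib atLeastAtMost_iff, linarith+)
  then have "d y = d x \<or> d y = Suc (d x)"
    by linarith
  then have "\<bar>g (real (d x) / 2 ^ m) - g (real (d y) / 2 ^ m)\<bar> \<le> (3/4) ^ m * s"
  proof
    assume e: "d y = Suc (d x)"
    have "real (d y) \<le> 1 * 2 ^ m"
      using le by (intro order_trans[OF d(1)] mult_right_mono) auto
    then have "real (Suc (d x)) \<le> real (2 ^ m)"
      by (simp only: e of_nat_power of_nat_numeral mult_1)
    then have "d x < 2 ^ m"
      by (simp only: of_nat_le_iff Suc_le_eq)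
    from step[OF \<open>J \<le> m\<close> this] show ?thesis
      unfolding e by (simp add: add.commute abs_minus_commute)
  qed (use \<open>0 \<le> s\<close> in simp)
  moreover have "\<bar>g z - g (real (d z) / 2 ^ m)\<bar> \<le> 3 * (3/4) ^ m * s" if "z \<in> {0..1}" for z
    unfolding d_def using assms that by (intro dyadic_chaining_point[where J=J]) auto
  note this[of x] this[of y]
  ultimately show ?case
    using le by (simp add: abs_le_iff)
next
  case (sym x y)
  then show ?case
    by (simp add: abs_minus_commute)
qed

text \<open>The ratio \<open>9/8\<close> is \<open>2 * (3/4)\<^sup>2\<close>, the squared threshold
  against the variance of a dyadic increment, per level. Half of the left side,
  \<open>2 + 2 * j\<close>, becomes the exponent of \<open>1 / k\<close>: 2 for summability in
  \<open>k\<close>, the rest to beat the \<open>2 ^ j\<close> cells of the level. The number 50 is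
  merely a level from which this holds.\<close>

lemma nine_eighths_power_ge: "50 \<le> j \<Longrightarrow> 4 + 4 * real j \<le> (9/8) ^ j"
proof (induction j rule: dec_induct)
  case (step j)
  then have "4 + 4 * real (Suc j) \<le> (9/8) * (4 + 4 * real j)"
    by simp
  also have "\<dots> \<le> (9/8) * (9/8) ^ j"
    using step by (intro mult_left_mono) auto
  finally show ?case
    by simp
qed (simp add: eval_nat_numeral)

text \<open>On \<open>{0..2 ^ k}\<close> a level-\<open>j\<close> increment has variance
  \<open>2 ^ k / 2 ^ j\<close>, so the Gaussian exponent is \<open>(9/8) ^ j * ln k / 2\<close>.
  Here \<open>ln k\<close> stands for the iterated logarithm of \<open>2 ^ k\<close>, up to an
  additive constant.\<close>

lemma (in standard_brownian_motion) dyadic_increment_tail: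
  assumes "2 \<le> k" "50 \<le> j"
  shows "prob {\<omega> \<in> space M. \<bar>B (2 ^ k * ((real i + 1) / 2 ^ j)) \<omega> - B (2 ^ k * (real i / 2 ^ j)) \<omega>\<bar>
      > (3/4) ^ j * sqrt (2 ^ k * ln (real k))} \<le> 2 * (1/4) ^ j / (real k)\<^sup>2"
proof -
  let ?s = "2 ^ k * (real i / 2 ^ j)" and ?t = "2 ^ k * ((real i + 1) / 2 ^ j)"
  have ln_k: "0 < ln (real k)"
    using assms by simp
  have diff: "?t - ?s = 2 ^ k / 2 ^ j"
    by (simp add: field_simps)
  have less: "?s < ?t"
    by (simp add: field_simps)
  have "prob {\<omega> \<in> space M. \<bar>B ?t \<omega> - B ?s \<omega>\<bar> > (3/4) ^ j * sqrt (2 ^ k * ln (real k))}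
      \<le> 2 * exp (- (((3/4) ^ j * sqrt (2 ^ k * ln (real k)))\<^sup>2 / (2 * (sqrt (?t - ?s))\<^sup>2)))"
    using gaussian_increments[OF _ less] less ln_k by (intro normal_abs_tail_upper) auto
  also have "((3/4) ^ j * sqrt (2 ^ k * ln (real k)))\<^sup>2 / (2 * (sqrt (?t - ?s))\<^sup>2) = (9/8) ^ j * ln (real k) / 2"
  proof -
    have a: "((3/4::real) ^ j)\<^sup>2 = (9/16) ^ j"
      by (simp add: power2_eq_square flip: power_mult_distrib)
    have b: "(9/16::real) ^ j * 2 ^ j = (9/8) ^ j"
      by (simp flip: power_mult_distrib)
    have c: "a * (K * l) / (2 * (K / L)) = a * L * l / 2" if "K \<noteq> 0" "L \<noteq> 0" for a K l L :: real
      using that by simp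
    have d: "(sqrt (2 ^ k * ln (real k)))\<^sup>2 = 2 ^ k * ln (real k)" "(sqrt (2 ^ k / 2 ^ j))\<^sup>2 = 2 ^ k / (2 ^ j :: real)"
      using ln_k by simp_all
    show ?thesis
      unfolding diff power_mult_distrib[of "(3/4) ^ j"] a d by (subst c) (simp_all add: b del: power_divide)
  qed
  also have "2 * exp (- ((9/8) ^ j * ln (real k) / 2)) \<le> 2 * exp (- ((2 + 2 * real j) * ln (real k)))"
    using mult_right_mono[OF nine_eighths_power_ge[OF \<open>50 \<le> j\<close>], of "ln (real k)"] ln_k by simp
  also have "\<dots> = 2 * inverse (real k ^ (2 + 2 * j))"
    using assms exp_of_nat_mult[of "2 + 2 * j" "ln (real k)"] by (simp add: exp_minus)
  also have "\<dots> \<le> 2 * ((1/4) ^ j / (real k)\<^sup>2)"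
  proof -
    have "(2::real) ^ (2 * j) \<le> real k ^ (2 * j)"
      using assms by (intro power_mono) auto
    then have "(4::real) ^ j \<le> real k ^ (2 * j)"
      by (simp add: power_mult)
    then have "(4::real) ^ j * (real k)\<^sup>2 \<le> real k ^ (2 + 2 * j)"
      unfolding power_add by (subst mult.commute) (intro mult_left_mono; simp)
    then have "inverse (real k ^ (2 + 2 * j)) \<le> inverse (4 ^ j * (real k)\<^sup>2)"
      using assms by (intro le_imp_inverse_le) auto
    then show ?thesis
      by (simp add: field_simps power_divide)
  qed
  finally show ?thesis
    by simp
qed

text \<open>The \<open>2 ^ j\<close> cells of level \<open>j\<close> together contribute at most
  \<open>2 * (1/2) ^ j / k\<^sup>2\<close>, summable first over the levels and then over
  \<open>k\<close>, so one event \<open>A k\<close> covers all fine levels at once. Only fine levels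
  matter for a modulus of continuity at small distances.\<close>

lemma (in standard_brownian_motion) dyadic_increments_AE:
  "AE \<omega> in M. \<forall>\<^sub>F k in sequentially. \<forall>j\<ge>50. \<forall>i<2 ^ j.
     \<bar>B (2 ^ k * ((real i + 1) / 2 ^ j)) \<omega> - B (2 ^ k * (real i / 2 ^ j)) \<omega>\<bar>
      \<le> (3/4) ^ j * sqrt (2 ^ k * ln (real k))"
proof -
  define E where "E k j i = {\<omega> \<in> space M.
    \<bar>B (2 ^ k * ((real i + 1) / 2 ^ j)) \<omega> - B (2 ^ k * (real i / 2 ^ j)) \<omega>\<bar>
      > (3/4) ^ j * sqrt (2 ^ k * ln (real k))}" for k j i :: nat
  define A where "A k = (\<Union>j. \<Union>i<2 ^ (j + 50). E k (j + 50) i)" for k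
  have E [measurable]: "E k j i \<in> sets M" for k j i
  proof -
    have [measurable]: "B (2 ^ k * ((real i + 1) / 2 ^ j)) \<in> borel_measurable M"
        "B (2 ^ k * (real i / 2 ^ j)) \<in> borel_measurable M"
      by (auto intro!: borel_measurable_values)
    show ?thesis
      unfolding E_def by measurable
  qed
  have A_le: "prob (A k) \<le> 4 / (real k)\<^sup>2" if "2 \<le> k" for k
  proof -
    have level: "prob (\<Union>i<2 ^ (j + 50). E k (j + 50) i) \<le> 2 / (real k)\<^sup>2 * (1/2) ^ j" for j
    proof -
      have "prob (\<Union>i<2 ^ (j + 50). E k (j + 50) i) \<le> (\<Sum>i<2 ^ (j + 50). prob (E k (j + 50) i))"
        by (intro finite_measure_subadditive_finite) auto
      also have "\<dots> \<le> (\<Sum>i<(2::nat) ^ (j + 50). 2 * (1/4) ^ (j + 50) / (real k)\<^sup>2)"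
        unfolding E_def using that by (intro sum_mono dyadic_increment_tail) auto
      also have "\<dots> = 2 / (real k)\<^sup>2 * (2 ^ (j + 50) * (1/4) ^ (j + 50))"
        by simp
      also have "(2::real) ^ (j + 50) * (1/4) ^ (j + 50) = (1/2) ^ (j + 50)"
        by (simp flip: power_mult_distrib)
      also have "\<dots> \<le> (1/2) ^ j"
        by (rule power_decreasing) auto
      finally show ?thesis
        by (simp add: divide_right_mono)
    qed
    have sums: "(\<lambda>j. 2 / (real k)\<^sup>2 * (1/2) ^ j) sums (2 / (real k)\<^sup>2 * 2)"
      using geometric_sums[of "1/2::real"] by (intro sums_mult) simp
    have summ: "summable (\<lambda>j. prob (\<Union>i<2 ^ (j + 50). E k (j + 50) i))"
      using level by (intro summable_comparison_test'[OF sums_summable[OF sums]]) auto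
    have "prob (A k) \<le> (\<Sum>j. prob (\<Union>i<2 ^ (j + 50). E k (j + 50) i))"
      unfolding A_def using summ by (intro finite_measure_subadditive_countably) auto
    also have "\<dots> \<le> (\<Sum>j. 2 / (real k)\<^sup>2 * (1/2) ^ j)"
      using level summ sums_summable[OF sums] by (intro suminf_le)
    also have "\<dots> = 4 / (real k)\<^sup>2"
      using sums_unique[OF sums] by simp
    finally show ?thesis .
  qed
  have "summable (\<lambda>k. prob (A k))"
  proof (rule summable_comparison_test')
    show "summable (\<lambda>k. 4 * inverse (real k ^ 2))"
      using inverse_power_summable[of 2, where 'a=real] by (intro summable_mult) simp
    show "norm (prob (A k)) \<le> 4 * inverse (real k ^ 2)" if "2 \<le> k" for k
      using A_le[OF that] by (simp add: divide_inverse)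
  qed
  then have "AE \<omega> in M. \<forall>\<^sub>F k in sequentially. \<omega> \<in> space M - A k"
    by (intro borel_cantelli_AE1) (auto simp: A_def less_top[symmetric])
  then show ?thesis
  proof eventually_elim
    case (elim \<omega>)
    then show ?case
    proof eventually_elim
      case (elim k)
      show ?case
      proof (intro allI impI)
        fix j i :: nat
        assume "50 \<le> j" "i < 2 ^ j"
        moreover have "\<omega> \<notin> E k (j - 50 + 50) i" if "i < 2 ^ (j - 50 + 50)"
          using elim that unfolding A_def by blast
        ultimately have "\<omega> \<notin> E k j i"
          by simp
        then show "\<bar>B (2 ^ k * ((real i + 1) / 2 ^ j)) \<omega> - B (2 ^ k * (real i / 2 ^ j)) \<omega>\<bar>
            \<le> (3/4) ^ j * sqrt (2 ^ k * ln (real k))"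
          using elim by (auto simp: E_def not_less)
      qed
    qed
  qed
qed

text \<open>Asymptotic equicontinuity of the rescaled paths taking \<open>x\<close> to
  \<open>b (t * x) / lil_scale t\<close> on the unit interval, written without division;
  \<open>\<delta>\<close> is found before \<open>t\<close>.\<close>

definition lil_equicontinuous :: "(real \<Rightarrow> real) \<Rightarrow> bool" where
  "lil_equicontinuous b \<longleftrightarrow> (\<forall>\<epsilon>>0. \<exists>\<delta>>0. \<forall>\<^sub>F t in at_top. \<forall>u\<in>{0..t}. \<forall>v\<in>{0..t}.
     \<bar>u - v\<bar> \<le> \<delta> * t \<longrightarrow> \<bar>b u - b v\<bar> \<le> \<epsilon> * lil_scale t)"

text \<open>The dyadic bounds live on \<open>{0..2 ^ k}\<close>; each large \<open>t\<close> is
  matched with a \<open>k\<close> such that \<open>t \<le> 2 ^ k \<le> 2 * t\<close>, at the price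
  of a constant in the scale.\<close>

lemma lil_equicontinuousI_dyadic:
  fixes b :: "real \<Rightarrow> real"
  assumes cont: "continuous_on {0..} b"
    and incr: "\<forall>\<^sub>F k in sequentially. \<forall>j\<ge>J. \<forall>i<2 ^ j.
      \<bar>b (2 ^ k * ((real i + 1) / 2 ^ j)) - b (2 ^ k * (real i / 2 ^ j))\<bar>
        \<le> (3/4) ^ j * sqrt (2 ^ k * ln (real k))"
  shows "lil_equicontinuous b"
  unfolding lil_equicontinuous_def
proof (intro allI impI)
  fix \<epsilon> :: real
  assume "0 < \<epsilon>"
  \<comment> \<open>\<open>14 = 7 * 2\<close>: 7 from the chaining bound, 2 from comparing
    \<open>sqrt (2 ^ k * ln k)\<close> with \<open>lil_scale t\<close>.\<close>
  have "\<forall>\<^sub>F m in sequentially. 14 * (3/4) ^ m < \<epsilon>"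
    using \<open>0 < \<epsilon>\<close> by real_asymp
  then have "\<forall>\<^sub>F m in sequentially. 14 * (3/4) ^ m < \<epsilon> \<and> J \<le> m"
    by (intro eventually_conj eventually_ge_at_top)
  then obtain m where m: "14 * (3/4) ^ m < \<epsilon>" "J \<le> m"
    by (auto simp: eventually_sequentially)
  from incr obtain K where K: "\<And>k j i. k \<ge> K \<Longrightarrow> j \<ge> J \<Longrightarrow> i < 2 ^ j \<Longrightarrow>
      \<bar>b (2 ^ k * ((real i + 1) / 2 ^ j)) - b (2 ^ k * (real i / 2 ^ j))\<bar>
        \<le> (3/4) ^ j * sqrt (2 ^ k * ln (real k))"
    by (auto simp: eventually_sequentially)
  \<comment> \<open>Prepares \<open>ln k \<le> 2 * ln (ln t)\<close> for the rounded-up exponent,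
    which satisfies \<open>k < log 2 t + 1\<close>.\<close>
  have lnln: "\<forall>\<^sub>F t::real in at_top. ln (ln t / ln 2 + 1) \<le> 2 * ln (ln t)"
    by real_asymp
  have "\<forall>\<^sub>F t in at_top. \<forall>u\<in>{0..t}. \<forall>v\<in>{0..t}.
     \<bar>u - v\<bar> \<le> 1 / 2 ^ m * t \<longrightarrow> \<bar>b u - b v\<bar> \<le> \<epsilon> * lil_scale t"
    using lnln eventually_gt_at_top[of "2 ^ K"] eventually_gt_at_top[of "exp 1"]
  proof eventually_elim
    case (elim t)
    define k where "k = nat \<lceil>log 2 t\<rceil>"
    have "1 < t"
      using elim one_less_exp_iff[of 1] by linarith
    then have log_pos: "0 < log 2 t"
      by simp
    then have k: "log 2 t \<le> real k" "real k < log 2 t + 1"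
      unfolding k_def by linarith+
    have "real K < log 2 t"
      using elim \<open>1 < t\<close> by (simp add: less_log_iff powr_realpow)
    with k have "K \<le> k"
      by linarith
    have "k > 0"
      using k log_pos by (intro gr0I) auto
    have t_le: "t \<le> 2 ^ k"
      using k(1) \<open>1 < t\<close> by (simp add: log_le_iff powr_realpow)
    have "2 powr real k \<le> 2 powr (log 2 t + 1)"
      using k(2) by simp
    then have le_t: "2 ^ k \<le> 2 * t"
      using \<open>1 < t\<close> by (simp add: powr_realpow powr_add)
    have "ln (real k) \<le> ln (ln t / ln 2 + 1)"
      using k \<open>k > 0\<close> by (simp add: log_def)
    with elim have ln_k: "ln (real k) \<le> 2 * ln (ln t)"
      by linarith
    have "sqrt (2 ^ k * ln (real k)) \<le> sqrt ((2 * t) * (2 * ln (ln t)))"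
      using le_t ln_k \<open>k > 0\<close> \<open>1 < t\<close> by (intro real_sqrt_le_mono mult_mono) auto
    also have "\<dots> \<le> sqrt (4 * (2 * t * ln (ln t)))"
    proof -
      have "1 \<le> ln t"
        using elim \<open>1 < t\<close> by (metis exp_gt_zero less_imp_le ln_exp ln_le_cancel_iff order.strict_trans)
      then show ?thesis
        using \<open>1 < t\<close> by simp
    qed
    also have "\<dots> = 2 * lil_scale t"
      unfolding lil_scale_def by (subst real_sqrt_mult) simp
    finally have scale: "sqrt (2 ^ k * ln (real k)) \<le> 2 * lil_scale t" .
    show ?case
    proof (intro ballI impI)
      fix u v
      assume uv: "u \<in> {0..t}" "v \<in> {0..t}" "\<bar>u - v\<bar> \<le> 1 / 2 ^ m * t"
      have "\<bar>u / 2 ^ k - v / 2 ^ k\<bar> = \<bar>u - v\<bar> / 2 ^ k"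
        by (simp add: diff_divide_distrib[symmetric])
      also have "\<dots> \<le> (1 / 2 ^ m * 2 ^ k) / 2 ^ k"
        using uv t_le by (intro divide_right_mono) (auto simp: field_simps intro: order_trans)
      finally have dist: "\<bar>u / 2 ^ k - v / 2 ^ k\<bar> \<le> 1 / 2 ^ m"
        by simp
      have "continuous_on {0..1} (\<lambda>x. b (2 ^ k * x))"
        by (intro continuous_on_compose2[OF cont] continuous_intros) auto
      then have "\<bar>b (2 ^ k * (u / 2 ^ k)) - b (2 ^ k * (v / 2 ^ k))\<bar>
          \<le> 7 * (3/4) ^ m * sqrt (2 ^ k * ln (real k))"
        using K[OF \<open>K \<le> k\<close>] dist uv t_le m \<open>k > 0\<close>
        by (intro dyadic_chaining[where J=J]) auto
      also have "\<dots> \<le> 7 * (3/4) ^ m * (2 * lil_scale t)"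
        using scale by (intro mult_left_mono) auto
      also have "\<dots> \<le> \<epsilon> * lil_scale t"
      proof -
        have "0 \<le> sqrt (2 ^ k * ln (real k))"
          using \<open>k > 0\<close> by simp
        then have "0 \<le> lil_scale t"
          using scale by linarith
        then show ?thesis
          using m mult_right_mono[of "14 * (3/4) ^ m" \<epsilon> "lil_scale t"] by simp
      qed
      finally show "\<bar>b u - b v\<bar> \<le> \<epsilon> * lil_scale t"
        by simp
    qed
  qed
  then show "\<exists>\<delta>>0. \<forall>\<^sub>F t in at_top. \<forall>u\<in>{0..t}. \<forall>v\<in>{0..t}.
     \<bar>u - v\<bar> \<le> \<delta> * t \<longrightarrow> \<bar>b u - b v\<bar> \<le> \<epsilon> * lil_scale t"
    by (intro exI[of _ "1 / 2 ^ m"]) simp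
qed

lemma (in standard_brownian_motion) lil_equicontinuous_AE:
  "AE \<omega> in M. lil_equicontinuous (\<lambda>u. B u \<omega>)"
  using continuous_paths dyadic_increments_AE
  by eventually_elim (rule lil_equicontinuousI_dyadic)

subsection \<open>Weighted sums of increments along geometric sequences\<close>

text \<open>For \<open>b 0 = 0\<close>, integration by parts turns the convolution divided by
  \<open>f t\<close> into the integral of \<open>f (t - u) / f t\<close> against \<open>b\<close>,
  up to a vanishing boundary term; for fixed \<open>u / t\<close> the kernel tends to
  \<open>(1 - u / t) powr \<alpha>\<close>. The limit is discretised at left endpoints, which makes
  the first weight exactly 1.\<close>

definition weighted_increments :: "real \<Rightarrow> nat \<Rightarrow> (real \<Rightarrow> real) \<Rightarrow> real \<Rightarrow> real" where
  "weighted_increments \<alpha> n b t =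
     (\<Sum>i<n. (real (n - i) / real n) powr \<alpha> * (b (t * (real (Suc i) / real n)) - b (t * (real i / real n))))"

definition weight_variance :: "real \<Rightarrow> nat \<Rightarrow> real" where
  "weight_variance \<alpha> n = (\<Sum>i<n. ((real (n - i) / real n) powr \<alpha>)\<^sup>2) / real n"

section \<open>The variance of the weighted sums\<close>

text \<open>Mean value theorem on a unit cell; telescoped, this compares a power sum with an
  integral. The cell at 0 is separate because the derivative is taken at positive points.\<close>

lemma powr_increment_bounds:
  fixes j :: nat and p :: real
  assumes "1 < p"
  shows "p * real j powr (p - 1) \<le> real (Suc j) powr p - real j powr p"
    and "real (Suc j) powr p - real j powr p \<le> p * real (Suc j) powr (p - 1)"
proof -
  have "p * real j powr (p - 1) \<le> real (Suc j) powr p - real j powr p \<and>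
      real (Suc j) powr p - real j powr p \<le> p * real (Suc j) powr (p - 1)"
  proof (cases "j = 0")
    case False
    have "((\<lambda>x. x powr p) has_real_derivative p * x powr (p - 1)) (at x)" if "real j \<le> x" for x
      using that False by (auto intro!: derivative_eq_intros)
    then obtain z where z: "z > real j" "z < real (Suc j)"
        "real (Suc j) powr p - real j powr p = (real (Suc j) - real j) * (p * z powr (p - 1))"
      using MVT2[of "real j" "real (Suc j)" "\<lambda>x. x powr p" "\<lambda>x. p * x powr (p - 1)"] by auto
    moreover have "real j powr (p - 1) \<le> z powr (p - 1)" "z powr (p - 1) \<le> real (Suc j) powr (p - 1)"
      using z assms by (auto intro!: powr_mono2)
    ultimately show ?thesis
      using assms by simp
  qed (use assms in simp)
  then show "p * real j powr (p - 1) \<le> real (Suc j) powr p - real j powr p"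
    "real (Suc j) powr p - real j powr p \<le> p * real (Suc j) powr (p - 1)"
    by auto
qed

text \<open>Read backwards, the sum is a power sum of exponent \<open>p - 1 = 2 * \<alpha>\<close>,
  squeezed between telescoping sums of \<open>p\<close>-th powers.\<close>

lemma weight_variance_tendsto:
  assumes "0 < \<alpha>"
  shows "weight_variance \<alpha> \<longlonglongrightarrow> 1 / (2 * \<alpha> + 1)"
proof -
  define p where "p = 2 * \<alpha> + 1"
  have p: "1 < p"
    using assms by (simp add: p_def)
  have var: "weight_variance \<alpha> n = (\<Sum>j<n. real (Suc j) powr (p - 1)) / real n powr p" if "0 < n" for n
  proof -
    have "(\<Sum>i<n. ((real (n - i) / real n) powr \<alpha>)\<^sup>2) = (\<Sum>i<n. ((real (Suc (n - Suc i)) / real n) powr \<alpha>)\<^sup>2)"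
      by (intro sum.cong) (auto simp: Suc_diff_Suc)
    also have "\<dots> = (\<Sum>j<n. ((real (Suc j) / real n) powr \<alpha>)\<^sup>2)"
      by (rule sum.nat_diff_reindex)
    also have "\<dots> = (\<Sum>j<n. real (Suc j) powr (p - 1) / real n powr (p - 1))"
    proof (rule sum.cong[OF refl])
      fix j
      have "((real (Suc j) / real n) powr \<alpha>)\<^sup>2 = (real (Suc j) / real n) powr (p - 1)"
        by (simp add: p_def power2_eq_square flip: powr_add)
      then show "((real (Suc j) / real n) powr \<alpha>)\<^sup>2 = real (Suc j) powr (p - 1) / real n powr (p - 1)"
        by (simp add: powr_divide)
    qed
    also have "\<dots> = (\<Sum>j<n. real (Suc j) powr (p - 1)) / real n powr (p - 1)"
      by (simp add: sum_divide_distrib)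
    also have "real n powr (p - 1) = real n powr p / real n"
      using that by (simp add: powr_diff)
    finally show ?thesis
      using that by (simp add: weight_variance_def)
  qed
  have lower: "1 / p \<le> weight_variance \<alpha> n" if "0 < n" for n
  proof -
    have "real n powr p = (\<Sum>j<n. real (Suc j) powr p - real j powr p)"
      using p by (subst sum_lessThan_telescope) simp
    also have "\<dots> \<le> (\<Sum>j<n. p * real (Suc j) powr (p - 1))"
      by (intro sum_mono powr_increment_bounds p)
    finally show ?thesis
      using that p by (simp add: var sum_distrib_left[symmetric] field_simps)
  qed
  have upper: "weight_variance \<alpha> n \<le> (1 + 1 / real n) powr p / p" if "0 < n" for n
  proof -
    \<comment> \<open>The lower increment bound is applied at \<open>Suc j\<close>, one cell to the
      right; this shift produces the factor \<open>(1 + 1 / n) powr p\<close>.\<close>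
    have "p * (\<Sum>j<n. real (Suc j) powr (p - 1)) \<le> (\<Sum>j<n. real (Suc (Suc j)) powr p - real (Suc j) powr p)"
      unfolding sum_distrib_left by (intro sum_mono powr_increment_bounds p)
    also have "\<dots> = real (Suc n) powr p - 1"
      by (subst sum_lessThan_telescope[where f="\<lambda>j. real (Suc j) powr p"]) simp
    finally have "p * (\<Sum>j<n. real (Suc j) powr (p - 1)) \<le> real (Suc n) powr p"
      by simp
    then have "p * (\<Sum>j<n. real (Suc j) powr (p - 1)) / real n powr p \<le> real (Suc n) powr p / real n powr p"
      by (intro divide_right_mono) auto
    also have "\<dots> = (1 + 1 / real n) powr p"
      using that by (simp add: field_simps flip: powr_divide)
    finally show ?thesis
      using that p by (simp add: var field_simps)
  qed
  have "weight_variance \<alpha> \<longlonglongrightarrow> 1 / p"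
  proof (rule tendsto_sandwich)
    show "\<forall>\<^sub>F n in sequentially. 1 / p \<le> weight_variance \<alpha> n"
      by (intro eventually_mono[OF eventually_gt_at_top[of 0]] lower)
    show "\<forall>\<^sub>F n in sequentially. weight_variance \<alpha> n \<le> (1 + 1 / real n) powr p / p"
      by (intro eventually_mono[OF eventually_gt_at_top[of 0]] upper)
    show "(\<lambda>n. (1 + 1 / real n) powr p / p) \<longlonglongrightarrow> 1 / p"
    proof -
      have "(\<lambda>n. 1 + 1 / real n) \<longlonglongrightarrow> 1"
        by real_asymp
      then have "(\<lambda>n. (1 + 1 / real n) powr p / p) \<longlonglongrightarrow> 1 powr p / p"
        using p by (intro tendsto_intros) auto
      then show ?thesis
        by simp
    qed
  qed simp
  then show ?thesis
    by (simp add: p_def)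
qed

text \<open>The first weight is 1, so the first increment accounts for exactly \<open>1 / n\<close>
  of the variance. What remains belongs to the increments that are independent of the past.\<close>

lemma weight_variance_split_first:
  assumes "0 < n"
  shows "real n * weight_variance \<alpha> n = 1 + (\<Sum>i<n - 1. ((real (n - Suc i) / real n) powr \<alpha>)\<^sup>2)"
  using assms sum.lessThan_Suc_shift[of "\<lambda>i. ((real (n - i) / real n) powr \<alpha>)\<^sup>2" "n - 1"]
  by (simp add: weight_variance_def)

lemma weight_variance_gt:
  assumes "2 \<le> n"
  shows "1 / real n < weight_variance \<alpha> n"
proof -
  have "0 < (\<Sum>i<n - 1. ((real (n - Suc i) / real n) powr \<alpha>)\<^sup>2)"
    using assms by (intro sum_pos) (auto simp: lessThan_empty_iff)
  then have "1 < real n * weight_variance \<alpha> n"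
    using assms weight_variance_split_first[of n \<alpha>] by simp
  then show ?thesis
    using assms by (simp add: field_simps)
qed

section \<open>Borel-Cantelli bounds along geometric sequences\<close>

lemma (in standard_brownian_motion) weighted_increments_distributed:
  assumes "0 < n" "0 < t"
  shows "distributed M lborel (\<lambda>\<omega>. weighted_increments \<alpha> n (\<lambda>u. B u \<omega>) t)
    (normal_density 0 (sqrt (t * weight_variance \<alpha> n)))"
proof -
  have "distributed M lborel (\<lambda>\<omega>. weighted_increments \<alpha> n (\<lambda>u. B u \<omega>) t)
      (normal_density 0 (sqrt (\<Sum>i<n. ((real (n - i) / real n) powr \<alpha>)\<^sup>2 * (t * (real (Suc i) / real n) - t * (real i / real n)))))"
    unfolding weighted_increments_def
    using assms by (intro weighted_increments_normal[where s="\<lambda>i. t * (real i / real n)"])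
      (auto simp: divide_strict_right_mono)
  also have "(\<Sum>i<n. ((real (n - i) / real n) powr \<alpha>)\<^sup>2 * (t * (real (Suc i) / real n) - t * (real i / real n)))
      = (\<Sum>i<n. ((real (n - i) / real n) powr \<alpha>)\<^sup>2 * (t / real n))"
    by (intro sum.cong) (auto simp: algebra_simps add_divide_distrib)
  also have "\<dots> = t * weight_variance \<alpha> n"
    unfolding weight_variance_def sum_distrib_right[symmetric] by simp
  finally show ?thesis .
qed

text \<open>With \<open>V\<close> the weight variance, the Gaussian tail bound at
  \<open>a * lil_scale (q ^ k)\<close> is twice \<open>(k * ln q) powr (- (a\<^sup>2 / V))\<close>,
  summable because \<open>a\<^sup>2 > V\<close>.\<close>

lemma (in standard_brownian_motion) weighted_increments_upper_AE:
  assumes "2 \<le> n" "1 < q" "sqrt (weight_variance \<alpha> n) < a"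
  shows "AE \<omega> in M. \<forall>\<^sub>F k in sequentially.
    \<bar>weighted_increments \<alpha> n (\<lambda>u. B u \<omega>) (q ^ k)\<bar> \<le> a * lil_scale (q ^ k)"
proof -
  let ?V = "weight_variance \<alpha> n"
  let ?G = "\<lambda>k \<omega>. weighted_increments \<alpha> n (\<lambda>u. B u \<omega>) (q ^ k)"
  define A where "A k = {\<omega> \<in> space M. \<bar>?G k \<omega>\<bar> > a * lil_scale (q ^ k)}" for k
  have V: "0 < ?V"
  proof -
    have "0 \<le> 1 / real n"
      by simp
    with weight_variance_gt[OF assms(1), of \<alpha>] show ?thesis
      by linarith
  qed
  have a: "0 < a" "1 < a\<^sup>2 / ?V"
  proof -
    have "0 < sqrt ?V"
      using V by simp
    then show "0 < a"
      using assms by linarith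
    have "(sqrt ?V)\<^sup>2 < a\<^sup>2"
      using \<open>0 < sqrt ?V\<close> assms by (intro power_strict_mono) auto
    then show "1 < a\<^sup>2 / ?V"
      using V by simp
  qed
  have dist: "distributed M lborel (?G k) (normal_density 0 (sqrt (q ^ k * ?V)))" for k
    using assms by (intro weighted_increments_distributed) auto
  have [measurable]: "?G k \<in> borel_measurable M" for k
    using distributed_measurable[OF dist] by simp
  \<comment> \<open>The condition on \<open>k\<close> says \<open>ln (q ^ k) > 1\<close>, which
    makes the iterated logarithm positive.\<close>
  have A_le: "prob (A k) \<le> 2 * (ln q powr (- (a\<^sup>2 / ?V)) * real k powr (- (a\<^sup>2 / ?V)))" if "1 / ln q < real k" for k
  proof -
    have lnq: "0 < ln q"
      using assms by simp
    have k: "1 < real k * ln q"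
      using that lnq by (simp add: field_simps)
    have scale: "(lil_scale (q ^ k))\<^sup>2 = 2 * q ^ k * ln (real k * ln q)" "0 \<le> lil_scale (q ^ k)"
      using assms k by (auto simp: lil_scale_def ln_realpow)
    have "prob (A k) \<le> 2 * exp (- ((a * lil_scale (q ^ k))\<^sup>2 / (2 * (sqrt (q ^ k * ?V))\<^sup>2)))"
      unfolding A_def using assms a V scale by (intro normal_abs_tail_upper dist) auto
    also have "(a * lil_scale (q ^ k))\<^sup>2 / (2 * (sqrt (q ^ k * ?V))\<^sup>2) = a\<^sup>2 / ?V * ln (real k * ln q)"
      using assms V by (simp add: power_mult_distrib scale)
    also have "exp (- (a\<^sup>2 / ?V * ln (real k * ln q))) = (real k * ln q) powr (- (a\<^sup>2 / ?V))"
      using k lnq by (cases "k = 0") (auto simp: powr_def)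
    also have "\<dots> = ln q powr (- (a\<^sup>2 / ?V)) * real k powr (- (a\<^sup>2 / ?V))"
      using lnq by (subst powr_mult) auto
    finally show ?thesis .
  qed
  obtain K where K: "1 / ln q < real K"
    using reals_Archimedean2 by blast
  have "summable (\<lambda>k. prob (A k))"
  proof (rule summable_comparison_test')
    show "summable (\<lambda>k. 2 * (ln q powr (- (a\<^sup>2 / ?V)) * real k powr (- (a\<^sup>2 / ?V))))"
      using a by (intro summable_mult) (simp add: summable_real_powr_iff)
    show "norm (prob (A k)) \<le> 2 * (ln q powr (- (a\<^sup>2 / ?V)) * real k powr (- (a\<^sup>2 / ?V)))" if "K \<le> k" for k
    proof -
      have "1 / ln q < real k"
        using K that by (meson less_le_trans of_nat_le_iff)
      with A_le[of k] show ?thesis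
        by simp
    qed
  qed
  then have "AE \<omega> in M. \<forall>\<^sub>F k in sequentially. \<omega> \<in> space M - A k"
    by (intro borel_cantelli_AE1) (auto simp: A_def less_top[symmetric])
  then show ?thesis
  proof eventually_elim
    case (elim \<omega>)
    then show ?case
      by eventually_elim (auto simp: A_def not_less)
  qed
qed

text \<open>Measurable functions of disjoint groups of independent variables are independent. All
  blocks lie on one grid \<open>s\<close>, since the locale states independence along a single
  monotone sequence of times.\<close>

lemma (in standard_brownian_motion) increment_blocks_indep:
  fixes s w :: "nat \<Rightarrow> real"
  assumes "0 \<le> s 0" "\<And>p. s p \<le> s (Suc p)"
  shows "indep_vars (\<lambda>_. borel)
    (\<lambda>k \<omega>. \<Sum>i<m. w i * (B (s (Suc (k * m + i))) \<omega> - B (s (k * m + i)) \<omega>)) {..<N}"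
proof -
  let ?X = "\<lambda>p \<omega>. B (s (Suc p)) \<omega> - B (s p) \<omega>"
  let ?K = "\<lambda>k. {k * m..<Suc k * m}"
  have "indep_vars (\<lambda>_. borel) ?X {..<N * m}"
    using assms by (intro independent_increments) auto
  then have "indep_vars (\<lambda>k. PiM (?K k) (\<lambda>_. borel)) (\<lambda>k \<omega>. restrict (\<lambda>p. ?X p \<omega>) (?K k)) {..<N}"
  proof (rule indep_vars_restrict)
    fix k
    assume "k \<in> {..<N}"
    then have "Suc k * m \<le> N * m"
      by (intro mult_right_mono) auto
    then show "?K k \<subseteq> {..<N * m}"
      by auto
  next
    show "disjoint_family_on ?K {..<N}"
    proof (unfold disjoint_family_on_def, intro ballI impI)
      fix k l :: nat
      assume "k \<noteq> l"
      have div: "p div m = k" if "p \<in> ?K k" for p k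
        using that by (intro div_nat_eqI) (auto simp: mult.commute)
      from div[of _ k] div[of _ l] \<open>k \<noteq> l\<close> show "?K k \<inter> ?K l = {}"
        by blast
    qed
  qed
  then have "indep_vars (\<lambda>_. borel)
      (\<lambda>k \<omega>. \<Sum>i<m. w i * (restrict (\<lambda>p. ?X p \<omega>) (?K k)) (k * m + i)) {..<N}"
    by (rule indep_vars_compose2[where Y="\<lambda>k x. \<Sum>i<m. w i * x (k * m + i)"])
       (auto intro!: borel_measurable_sum borel_measurable_times measurable_component_singleton)
  then show ?thesis
    by simp
qed

text \<open>Along \<open>t = n ^ (k + 1)\<close> the increments of \<open>weighted_increments \<alpha> n b t\<close> other than the
  first one fill the interval from \<open>n ^ k\<close> to \<open>n ^ (k + 1)\<close>, so that their weighted sums are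
  independent for different \<open>k\<close>.\<close>

lemma (in standard_brownian_motion) weighted_increments_lower_AE:
  assumes "2 \<le> n" "a < sqrt (weight_variance \<alpha> n - 1 / real n)" "\<bar>c\<bar> = 1"
  shows "AE \<omega> in M. \<exists>\<^sub>F k in sequentially.
    c * (weighted_increments \<alpha> n (\<lambda>u. B u \<omega>) (real n ^ Suc k) - (B (real n ^ k) \<omega> - B 0 \<omega>))
      > a * lil_scale (real n ^ Suc k)"
proof -
  define m where "m = n - 1"
  have m: "0 < m" "n = Suc m"
    using assms by (auto simp: m_def)
  \<comment> \<open>Block \<open>k\<close> of the grid consists of \<open>n ^ k * 1\<close>, ...,
    \<open>n ^ k * m\<close>; its right end \<open>n ^ k * n\<close> is the first point of block
    \<open>k + 1\<close>, which is the case \<open>i = m\<close> below.\<close>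
  define s where "s p = real n ^ (p div m) * (real (p mod m) + 1)" for p
  have s_block: "s (k * m + i) = real n ^ k * (real i + 1)" if "i \<le> m" for k i
  proof (cases "i = m")
    case True
    have "(k * m + m) div m = Suc k"
      using m(1) nonzero_mult_div_cancel_right[of m "Suc k"] by (simp add: add.commute)
    moreover have "(k * m + m) mod m = 0"
      by simp
    ultimately show ?thesis
      unfolding s_def True using m by simp
  next
    case False
    then show ?thesis
      using that by (simp add: s_def)
  qed
  have s_mono: "s p < s (Suc p)" for p
  proof -
    have "p mod m < m"
      using m by simp
    moreover have "p div m * m + p mod m = p"
      by simp
    ultimately have "s p = real n ^ (p div m) * (real (p mod m) + 1)"
      "s (Suc p) = real n ^ (p div m) * (real (p mod m) + 2)"
      using s_block[of "p mod m" "p div m"] s_block[of "Suc (p mod m)" "p div m"]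
      by (simp_all add: add.commute)
    then show ?thesis
      using assms by simp
  qed
  \<comment> \<open>The weights are shifted by one because the increment over
    \<open>{0..n ^ k}\<close>, of weight 1, is left out; the sign \<open>c\<close> serves both
    extremes.\<close>
  define w where "w i = c * (real (n - Suc i) / real n) powr \<alpha>" for i
  define D where "D k \<omega> = (\<Sum>i<m. w i * (B (s (Suc (k * m + i))) \<omega> - B (s (k * m + i)) \<omega>))" for k \<omega>
  define \<tau> where "\<tau> = weight_variance \<alpha> n - 1 / real n"
  have "0 < \<tau>"
    using weight_variance_gt[OF assms(1)] by (simp add: \<tau>_def)
  have D_eq: "D k \<omega> = c * (weighted_increments \<alpha> n (\<lambda>u. B u \<omega>) (real n ^ Suc k) - (B (real n ^ k) \<omega> - B 0 \<omega>))" for k \<omega>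
  proof -
    have sc: "real n ^ Suc k * (x / real n) = real n ^ k * x" for x
      using m by simp
    have "D k \<omega> = (\<Sum>i<m. w i * (B (real n ^ k * (real i + (1 + 1))) \<omega> - B (real n ^ k * (real i + 1)) \<omega>))"
      unfolding D_def
    proof (intro sum.cong refl)
      fix i
      assume "i \<in> {..<m}"
      then show "w i * (B (s (Suc (k * m + i))) \<omega> - B (s (k * m + i)) \<omega>) =
          w i * (B (real n ^ k * (real i + (1 + 1))) \<omega> - B (real n ^ k * (real i + 1)) \<omega>)"
        using s_block[of i k] s_block[of "Suc i" k] by (simp add: add.commute)
    qed
    also have "\<dots> = c * (\<Sum>i<m. (real (n - Suc i) / real n) powr \<alpha> *
        (B (real n ^ k * (real i + (1 + 1))) \<omega> - B (real n ^ k * (real i + 1)) \<omega>))"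
      by (simp add: w_def sum_distrib_left mult.assoc)
    also have "(\<Sum>i<m. (real (n - Suc i) / real n) powr \<alpha> *
        (B (real n ^ k * (real i + (1 + 1))) \<omega> - B (real n ^ k * (real i + 1)) \<omega>)) =
      weighted_increments \<alpha> n (\<lambda>u. B u \<omega>) (real n ^ Suc k) - (B (real n ^ k) \<omega> - B 0 \<omega>)"
    proof -
      let ?f = "\<lambda>i. (real (n - i) / real n) powr \<alpha> *
          (B (real n ^ k * real (Suc i)) \<omega> - B (real n ^ k * real i) \<omega>)"
      have "weighted_increments \<alpha> n (\<lambda>u. B u \<omega>) (real n ^ Suc k) = sum ?f {..<n}"
        by (simp only: weighted_increments_def sc)
      also have "\<dots> = ?f 0 + (\<Sum>i<m. ?f (Suc i))"
        by (subst m(2), rule sum.lessThan_Suc_shift)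
      also have "?f 0 = B (real n ^ k) \<omega> - B 0 \<omega>"
        using assms by simp
      also have "(\<Sum>i<m. ?f (Suc i)) = (\<Sum>i<m. (real (n - Suc i) / real n) powr \<alpha> *
        (B (real n ^ k * (real i + (1 + 1))) \<omega> - B (real n ^ k * (real i + 1)) \<omega>))"
        by (intro sum.cong refl) (simp only: of_nat_Suc add_ac)
      finally show ?thesis
        by (simp only: add_diff_cancel_left')
    qed
    finally show ?thesis .
  qed
  have var: "(\<Sum>i<m. (w i)\<^sup>2 * (s (Suc (k * m + i)) - s (k * m + i))) = real n ^ Suc k * \<tau>" for k
  proof -
    have "c\<^sup>2 = 1"
      using assms by (metis power2_abs power_one)
    have "(\<Sum>i<m. (w i)\<^sup>2 * (s (Suc (k * m + i)) - s (k * m + i))) =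
        (\<Sum>i<m. ((real (n - Suc i) / real n) powr \<alpha>)\<^sup>2 * real n ^ k)"
    proof (intro sum.cong refl)
      fix i
      assume "i \<in> {..<m}"
      then show "(w i)\<^sup>2 * (s (Suc (k * m + i)) - s (k * m + i)) =
          ((real (n - Suc i) / real n) powr \<alpha>)\<^sup>2 * real n ^ k"
        using s_block[of i k] s_block[of "Suc i" k] \<open>c\<^sup>2 = 1\<close>
        by (simp add: w_def power_mult_distrib algebra_simps)
    qed
    also have "\<dots> = real n ^ k * (real n * \<tau>)"
      using assms weight_variance_split_first[of n \<alpha>]
      by (simp add: \<tau>_def right_diff_distrib sum_distrib_right[symmetric] m_def)
    finally show ?thesis
      by simp
  qed
  have dist: "distributed M lborel (D k) (normal_density 0 (sqrt (real n ^ Suc k * \<tau>)))" for k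
  proof -
    have "w i \<noteq> 0" if "i < m" for i
      using that m assms by (auto simp: w_def)
    moreover have "0 \<le> s (k * m)"
      by (simp add: s_def)
    ultimately have "distributed M lborel (D k)
      (normal_density 0 (sqrt (\<Sum>i<m. (w i)\<^sup>2 * (s (Suc (k * m + i)) - s (k * m + i)))))"
      unfolding D_def using s_mono m
        weighted_increments_normal[where s="\<lambda>i. s (k * m + i)" and c=w and n=m] by simp
    then show ?thesis
      unfolding var .
  qed
  \<comment> \<open>Subtracting 1 cancels the shift in \<open>normal_tail_lower\<close>: the lower
    bound becomes \<open>1 / (ln (n ^ Suc k) * sqrt (2 * pi))\<close>, a multiple of the harmonic
    series.\<close>
  define x where "x k = sqrt (2 * ln (ln (real n ^ Suc k))) - 1" for k
  have io: "AE \<omega> in M. \<exists>\<^sub>F k in sequentially. D k \<omega> > sqrt (real n ^ Suc k * \<tau>) * x k"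
  proof (rule borel_cantelli_AE2)
    have "0 \<le> s 0"
      by (simp add: s_def)
    then show "indep_vars (\<lambda>_. borel) D {..<N}" for N
      unfolding D_def using s_mono less_imp_le by (intro increment_blocks_indep) auto
  next
    have lnn: "0 < ln (real n)"
      using assms by simp
    have "\<forall>\<^sub>F k in sequentially. 1 / (real (Suc k) * (ln (real n) * sqrt (2 * pi)))
        \<le> prob {\<omega> \<in> space M. D k \<omega> > sqrt (real n ^ Suc k * \<tau>) * x k}"
    proof -
      have "\<forall>\<^sub>F k in sequentially. 1 \<le> 2 * ln (real (Suc k) * ln (real n))"
        using lnn by real_asymp
      then show ?thesis
      proof eventually_elim
        case (elim k)
        have "x k + 1 = sqrt (2 * ln (real (Suc k) * ln (real n)))"
          using assms unfolding x_def by (subst ln_realpow) auto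
        moreover from elim have "1 \<le> sqrt (2 * ln (real (Suc k) * ln (real n)))"
          by simp
        moreover from elim have "(sqrt (2 * ln (real (Suc k) * ln (real n))))\<^sup>2 = 2 * ln (real (Suc k) * ln (real n))"
          by (intro real_sqrt_pow2) linarith
        ultimately have x: "0 \<le> x k" "(x k + 1)\<^sup>2 / 2 = ln (real (Suc k) * ln (real n))"
          by (linarith, simp)
        have "exp (- (x k + 1)\<^sup>2 / 2) / sqrt (2 * pi)
            \<le> prob {\<omega> \<in> space M. D k \<omega> > sqrt (real n ^ Suc k * \<tau>) * x k}"
          using x m \<open>0 < \<tau>\<close> by (intro normal_tail_lower dist) auto
        also have "- (x k + 1)\<^sup>2 / 2 = - ln (real (Suc k) * ln (real n))"
          using x by simp
        also have "exp (- ln (real (Suc k) * ln (real n))) / sqrt (2 * pi) =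
            1 / (real (Suc k) * (ln (real n) * sqrt (2 * pi)))"
          using lnn by (simp add: exp_minus divide_inverse)
        finally show ?case .
      qed
    qed
    moreover have "\<not> summable (\<lambda>k. 1 / (real (Suc k) * (ln (real n) * sqrt (2 * pi))))"
    proof
      assume "summable (\<lambda>k. 1 / (real (Suc k) * (ln (real n) * sqrt (2 * pi))))"
      then have "summable (\<lambda>k. C * (1 / (real (Suc k) * C)))" if "C = ln (real n) * sqrt (2 * pi)" for C
        unfolding that by (rule summable_mult)
      then have "summable (\<lambda>k. inverse (real (Suc k)))"
        using lnn by (simp add: inverse_eq_divide)
      then have "summable (\<lambda>k. inverse (real k))"
        by (subst (asm) summable_Suc_iff)
      then show False
        using not_summable_harmonic by blast
    qed
    moreover have "norm (1 / (real (Suc k) * (ln (real n) * sqrt (2 * pi)))) = 1 / (real (Suc k) * (ln (real n) * sqrt (2 * pi)))" for k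
      using lnn unfolding real_norm_def by (intro abs_of_nonneg) simp
    ultimately show "\<not> summable (\<lambda>k. prob {\<omega> \<in> space M. D k \<omega> > sqrt (real n ^ Suc k * \<tau>) * x k})"
      using summable_comparison_test_ev[of "\<lambda>k. 1 / (real (Suc k) * (ln (real n) * sqrt (2 * pi)))"
          "\<lambda>k. prob {\<omega> \<in> space M. D k \<omega> > sqrt (real n ^ Suc k * \<tau>) * x k}"]
      by presburger
  qed
  \<comment> \<open>The subtracted 1 stays fixed while \<open>sqrt (2 * ln (ln t))\<close> grows, so
    the strict gap between \<open>a\<close> and \<open>sqrt \<tau>\<close> absorbs it.\<close>
  have scale: "\<forall>\<^sub>F k in sequentially. a * lil_scale (real n ^ Suc k) \<le> sqrt (real n ^ Suc k * \<tau>) * x k"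
  proof -
    have "\<forall>\<^sub>F t in at_top. a * sqrt (2 * ln (ln t)) \<le> sqrt \<tau> * (sqrt (2 * ln (ln t)) - 1)"
    proof -
      have "\<forall>\<^sub>F t::real in at_top. sqrt \<tau> / (sqrt \<tau> - a) \<le> sqrt (2 * ln (ln t))"
        by real_asymp
      then show ?thesis
      proof eventually_elim
        case (elim t)
        then show ?case
          using assms(2) unfolding \<tau>_def[symmetric] by (simp add: pos_divide_le_eq algebra_simps)
      qed
    qed
    moreover have "filterlim (\<lambda>k. real n ^ Suc k) at_top sequentially"
      using assms by real_asymp
    ultimately have "\<forall>\<^sub>F k in sequentially. a * sqrt (2 * ln (ln (real n ^ Suc k)))
        \<le> sqrt \<tau> * (sqrt (2 * ln (ln (real n ^ Suc k))) - 1)"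
      by (rule eventually_compose_filterlim)
    then show ?thesis
    proof eventually_elim
      case (elim k)
      have "a * lil_scale (real n ^ Suc k) = sqrt (real n ^ Suc k) * (a * sqrt (2 * ln (ln (real n ^ Suc k))))"
        unfolding lil_scale_def by (simp add: real_sqrt_mult del: power_Suc)
      also have "\<dots> \<le> sqrt (real n ^ Suc k) * (sqrt \<tau> * x k)"
        unfolding x_def using elim by (intro mult_left_mono) auto
      finally show ?case
        by (simp add: real_sqrt_mult del: power_Suc)
    qed
  qed
  from io show ?thesis
  proof eventually_elim
    case (elim \<omega>)
    from frequently_eventually_frequently[OF this scale] show ?case
      unfolding D_eq by (rule frequently_elim1) auto
  qed
qed

subsection \<open>Primitives of regularly varying functions\<close>

text \<open>Since \<open>2 * 2 powr (\<alpha> - 1) = 2 powr \<alpha> > 1\<close>, eventually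
  \<open>f' t < 2 * f' (2 * t)\<close>. Hence the gap \<open>f (2 * t) - f t\<close> is eventually
  positive and nondecreasing, and each doubling of \<open>t\<close> adds at least a fixed amount to
  \<open>f\<close>. Divergence of \<open>f\<close> then admits l'Hopital's rule, and regular
  variation governs the quotient of the derivatives.\<close>

lemma
  fixes f f' :: "real \<Rightarrow> real"
  assumes "0 < \<alpha>"
    and deriv: "\<And>x. 0 \<le> x \<Longrightarrow> (f has_real_derivative f' x) (at x within {0..})"
    and rv: "regularly_varying f' (\<alpha> - 1)"
  shows regularly_varying_primitive_at_top: "filterlim f at_top at_top"
    and regularly_varying_primitive: "0 \<le> c \<Longrightarrow> ((\<lambda>t. f (c * t) / f t) \<longlongrightarrow> c powr \<alpha>) at_top"
proof -
  have pos: "\<forall>\<^sub>F t in at_top. f' t > 0"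
    and lim: "\<And>c. c > 0 \<Longrightarrow> ((\<lambda>t. f' (c * t) / f' t) \<longlongrightarrow> c powr (\<alpha> - 1)) at_top"
    using rv by (auto simp: regularly_varying_def)
  have D: "(f has_real_derivative f' x) (at x)" if "0 < x" for x
    using deriv[of x] that at_within_open_subset[of x "{0<..}" "{0..}"] by (auto simp: subset_eq)
  have D_scaled: "((\<lambda>t. f (c * t)) has_real_derivative c * f' (c * t)) (at t)" if "0 < c" "0 < t" for c t
  proof -
    have "((\<lambda>t. c * t) has_real_derivative c) (at t)"
      by (auto intro!: derivative_eq_intros)
    from DERIV_chain2[where g="\<lambda>t. c * t", OF D this] that show ?thesis
      by (simp add: mult.commute[of c "f' _"])
  qed
  have "1 / 2 < (2::real) powr (\<alpha> - 1)"
    using \<open>0 < \<alpha>\<close> powr_less_mono[of "-1" "\<alpha> - 1" "2::real"] by (simp add: powr_minus)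
  then have "\<forall>\<^sub>F t in at_top. 1 / 2 < f' (2 * t) / f' t"
    using lim[of 2] by (intro order_tendstoD) auto
  with pos have "\<forall>\<^sub>F t in at_top. 0 < f' t \<and> f' t < 2 * f' (2 * t)"
    by eventually_elim (simp add: field_simps)
  then obtain T0 where T0: "\<And>t. T0 \<le> t \<Longrightarrow> 0 < f' t \<and> f' t < 2 * f' (2 * t)"
    by (auto simp: eventually_at_top_linorder)
  define T where "T = max T0 1"
  have T: "0 < T" "\<And>t. T \<le> t \<Longrightarrow> 0 < f' t" "\<And>t. T \<le> t \<Longrightarrow> f' t \<le> 2 * f' (2 * t)"
    using T0 by (auto simp: T_def less_imp_le)
  have f_mono: "f s \<le> f t" if "T \<le> s" "s \<le> t" for s t
  proof (rule DERIV_nonneg_imp_nondecreasing[OF that(2)])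
    fix x
    assume "s \<le> x" "x \<le> t"
    then show "\<exists>y. (f has_real_derivative y) (at x) \<and> 0 \<le> y"
      using that T D[of x] less_imp_le[OF T(2)[of x]] by (intro exI[of _ "f' x"]) auto
  qed
  have gap_mono: "f (2 * T) - f T \<le> f (2 * t) - f t" if "T \<le> t" for t
  proof (rule DERIV_nonneg_imp_nondecreasing[OF that, where f="\<lambda>t. f (2 * t) - f t"])
    fix x
    assume "T \<le> x" "x \<le> t"
    then show "\<exists>y. ((\<lambda>t. f (2 * t) - f t) has_real_derivative y) (at x) \<and> 0 \<le> y"
      using T D_scaled[of 2 x] D[of x] by (intro exI[of _ "2 * f' (2 * x) - f' x"]) (auto intro!: DERIV_diff)
  qed
  define d where "d = f (2 * T) - f T"
  have "f T < f (2 * T)"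
  proof (rule DERIV_pos_imp_increasing[where f=f])
    fix x
    assume "T \<le> x" "x \<le> 2 * T"
    then show "\<exists>y. (f has_real_derivative y) (at x) \<and> 0 < y"
      using T D[of x] by (intro exI[of _ "f' x"]) auto
  qed (use T in simp)
  then have "0 < d"
    by (simp add: d_def)
  have growth: "f T + real k * d \<le> f (2 ^ k * T)" for k
  proof (induction k)
    case (Suc k)
    have "T \<le> 2 ^ k * T"
      using T by simp
    then have "d \<le> f (2 * (2 ^ k * T)) - f (2 ^ k * T)"
      unfolding d_def by (rule gap_mono)
    with Suc show ?case
      by (simp add: algebra_simps)
  qed simp
  show top: "filterlim f at_top at_top"
    unfolding filterlim_at_top
  proof
    fix C
    obtain k where "(C - f T) / d < real k"
      using reals_Archimedean2 by blast
    then have "C \<le> f (2 ^ k * T)"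
      using growth[of k] \<open>0 < d\<close> by (simp add: field_simps)
    moreover have "f (2 ^ k * T) \<le> f t" if "2 ^ k * T \<le> t" for t
      using f_mono[of "2 ^ k * T" t] that T by simp
    ultimately show "\<forall>\<^sub>F t in at_top. C \<le> f t"
      by (auto simp: eventually_at_top_linorder intro: order_trans)
  qed
  show "((\<lambda>t. f (c * t) / f t) \<longlongrightarrow> c powr \<alpha>) at_top" if "0 \<le> c"
  proof (cases "c = 0")
    \<comment> \<open>Here \<open>f 0 / f t\<close> tends to 0 and
      \<open>0 powr \<alpha> = 0\<close>; the grid point \<open>j = 0\<close> will need this
      value.\<close>
    case True
    then show ?thesis
      using tendsto_divide_0[OF tendsto_const filterlim_at_top_imp_at_infinity[OF top], of "f 0"] by simp
  next
    case False
    with that have "0 < c"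
      by simp
    show ?thesis
    proof (rule lhospital_at_top_at_top[OF top])
      show "\<forall>\<^sub>F t in at_top. f' t \<noteq> 0"
        using pos by eventually_elim simp
      show "\<forall>\<^sub>F t in at_top. ((\<lambda>t. f (c * t)) has_real_derivative c * f' (c * t)) (at t)"
        using eventually_gt_at_top[of 0] by eventually_elim (rule D_scaled[OF \<open>0 < c\<close>])
      show "\<forall>\<^sub>F t in at_top. (f has_real_derivative f' t) (at t)"
        using eventually_gt_at_top[of 0] by eventually_elim (rule D)
      have "((\<lambda>t. c * (f' (c * t) / f' t)) \<longlongrightarrow> c * c powr (\<alpha> - 1)) at_top"
        by (intro tendsto_intros lim \<open>0 < c\<close>)
      moreover have "c * c powr (\<alpha> - 1) = c powr \<alpha>"
        using \<open>0 < c\<close> by (simp add: powr_diff)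
      ultimately show "((\<lambda>t. c * f' (c * t) / f' t) \<longlongrightarrow> c powr \<alpha>) at_top"
        by simp
    qed
  qed
qed

section \<open>Pathwise bounds, summation by parts and step approximation\<close>

text \<open>The way from 0 to \<open>u\<close> is cut into \<open>N\<close> steps of length at most
  \<open>\<delta> * t\<close>, each costing at most \<open>lil_scale t\<close> by the modulus for
  \<open>\<epsilon> = 1\<close>; so \<open>K = N\<close>.\<close>

lemma lil_equicontinuous_bounded:
  assumes "lil_equicontinuous b" "b 0 = 0"
  shows "\<exists>K\<ge>0. \<forall>\<^sub>F t in at_top. \<forall>u\<in>{0..t}. \<bar>b u\<bar> \<le> K * lil_scale t"
proof -
  obtain \<delta> where \<delta>: "\<delta> > 0" "\<forall>\<^sub>F t in at_top. \<forall>u\<in>{0..t}. \<forall>v\<in>{0..t}.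
     \<bar>u - v\<bar> \<le> \<delta> * t \<longrightarrow> \<bar>b u - b v\<bar> \<le> 1 * lil_scale t"
    using assms(1) unfolding lil_equicontinuous_def by (meson zero_less_one)
  obtain N where N: "1 / \<delta> < real N"
    using reals_Archimedean2 by blast
  have "0 < real N"
    using N \<open>\<delta> > 0\<close> zero_less_divide_1_iff[of \<delta>] by linarith
  then have N': "1 / real N \<le> \<delta>" "0 < real N"
    using N \<open>\<delta> > 0\<close> by (simp_all add: field_simps)
  have "\<forall>\<^sub>F t in at_top. \<forall>u\<in>{0..t}. \<bar>b u\<bar> \<le> real N * lil_scale t"
    using \<delta>(2)
  proof eventually_elim
    case (elim t)
    show ?case
    proof
      fix u
      assume u: "u \<in> {0..t}"
      let ?p = "\<lambda>j. u * (real j / real N)"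
      have p: "?p j \<in> {0..t}" if "j \<le> N" for j
      proof -
        have "?p j \<le> u * 1"
          using that u N' by (intro mult_left_mono) auto
        then show ?thesis
          using u by auto
      qed
      have dist: "\<bar>?p (Suc j) - ?p j\<bar> \<le> \<delta> * t" for j
      proof -
        have "?p (Suc j) - ?p j = u * (1 / real N)"
          by (simp add: algebra_simps add_divide_distrib)
        moreover have "u * (1 / real N) \<le> t * \<delta>"
          using u N' by (intro mult_mono) auto
        ultimately show ?thesis
          using u N' by (simp add: mult.commute)
      qed
      have step: "\<bar>b (?p (Suc j)) - b (?p j)\<bar> \<le> lil_scale t" if "j < N" for j
      proof -
        have "?p (Suc j) \<in> {0..t}" "?p j \<in> {0..t}"
          using that by (intro p; simp)+
        with elim dist[of j] show ?thesis
          by (metis mult_1)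
      qed
      have "b u = (\<Sum>j<N. b (?p (Suc j)) - b (?p j))"
        using N' assms(2) by (subst sum_lessThan_telescope[where f="\<lambda>j. b (?p j)"]) simp
      also have "\<bar>\<dots>\<bar> \<le> (\<Sum>j<N. lil_scale t)"
        by (rule order_trans[OF sum_abs sum_mono], rule step) simp
      finally show "\<bar>b u\<bar> \<le> real N * lil_scale t"
        by simp
    qed
  qed
  then show ?thesis
    by (intro exI[of _ "real N"]) simp
qed

text \<open>Summation by parts restores the shape of the convolution: path values at
  \<open>t - t * j / n\<close> against increments of \<open>y powr \<alpha>\<close>.\<close>

lemma weighted_increments_abel:
  assumes "0 < n" "b 0 = 0"
  shows "weighted_increments \<alpha> n b t =
    (\<Sum>j<n. b (t * (real (n - j) / real n)) * ((real (Suc j) / real n) powr \<alpha> - (real j / real n) powr \<alpha>))"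
proof -
  define w where "w j = (real j / real n) powr \<alpha>" for j
  define \<beta> where "\<beta> j = b (t * (real (n - j) / real n))" for j
  have "weighted_increments \<alpha> n b t = (\<Sum>i<n. w (Suc (n - Suc i)) * (\<beta> (n - Suc i) - \<beta> (Suc (n - Suc i))))"
    unfolding weighted_increments_def w_def \<beta>_def
    by (intro sum.cong) (auto simp: Suc_diff_Suc simp del: of_nat_Suc)
  also have "\<dots> = (\<Sum>j<n. w (Suc j) * (\<beta> j - \<beta> (Suc j)))"
    by (rule sum.nat_diff_reindex)
  also have "\<dots> = (\<Sum>j<n. \<beta> j * (w (Suc j) - w j)) - (\<Sum>j<n. w (Suc j) * \<beta> (Suc j) - w j * \<beta> j)"
    unfolding sum_subtractf[symmetric] by (intro sum.cong) (auto simp: algebra_simps)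
  also have "(\<Sum>j<n. w (Suc j) * \<beta> (Suc j) - w j * \<beta> j) = w n * \<beta> n - w 0 * \<beta> 0"
    by (rule sum_lessThan_telescope)
  \<comment> \<open>Both boundary terms vanish: \<open>\<beta> n = b 0 = 0\<close>, and
    \<open>w 0\<close> is a power of 0, which is 0 for every exponent.\<close>
  also have "\<dots> = 0"
    using assms by (simp add: w_def \<beta>_def)
  finally show ?thesis
    by (simp add: w_def \<beta>_def)
qed

lemma set_integrable_reflected_mult:
  fixes b g :: "real \<Rightarrow> real"
  assumes cont: "continuous_on {0..} b" and g: "set_integrable lborel {0..t} g"
  shows "set_integrable lborel {0..t} (\<lambda>x. b (t - x) * g x)"
proof -
  have cont': "continuous_on {0..t} (\<lambda>x. b (t - x))"
    by (intro continuous_on_compose2[OF cont] continuous_intros) auto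
  then have "bounded ((\<lambda>x. b (t - x)) ` {0..t})"
    by (intro compact_imp_bounded compact_continuous_image) auto
  then obtain C where C: "\<And>x. x \<in> {0..t} \<Longrightarrow> \<bar>b (t - x)\<bar> \<le> C"
    unfolding bounded_iff by fastforce
  have meas: "(\<lambda>x. indicat_real {0..t} x *\<^sub>R b (t - x)) \<in> borel_measurable borel"
    by (intro borel_measurable_continuous_on_indicator cont') auto
  have g': "integrable lborel (\<lambda>x. indicat_real {0..t} x *\<^sub>R g x)"
    using g by (simp add: set_integrable_def)
  \<comment> \<open>Each factor carries its own indicator, since measurability of either is known on
    \<open>{0..t}\<close> only.\<close>
  have "integrable lborel (\<lambda>x. (indicat_real {0..t} x *\<^sub>R b (t - x)) * (indicat_real {0..t} x *\<^sub>R g x))"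
  proof (rule Bochner_Integration.integrable_bound)
    show "integrable lborel (\<lambda>x. C * (indicat_real {0..t} x *\<^sub>R g x))"
      using g' by simp
    show "(\<lambda>x. (indicat_real {0..t} x *\<^sub>R b (t - x)) * (indicat_real {0..t} x *\<^sub>R g x)) \<in> borel_measurable lborel"
      using meas borel_measurable_integrable[OF g'] by simp
    show "AE x in lborel. norm ((indicat_real {0..t} x *\<^sub>R b (t - x)) * (indicat_real {0..t} x *\<^sub>R g x))
        \<le> norm (C * (indicat_real {0..t} x *\<^sub>R g x))"
      using C by (intro AE_I2) (force simp: abs_mult intro!: mult_right_mono split: split_indicator)
  qed
  moreover have "(\<lambda>x. (indicat_real {0..t} x *\<^sub>R b (t - x)) * (indicat_real {0..t} x *\<^sub>R g x)) =
      (\<lambda>x. indicat_real {0..t} x *\<^sub>R (b (t - x) * g x))"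
    by (auto simp: fun_eq_iff split: split_indicator)
  ultimately show ?thesis
    by (simp add: set_integrable_def)
qed

lemma integral_sum_partition:
  fixes g :: "real \<Rightarrow> real" and p :: "nat \<Rightarrow> real"
  assumes "g integrable_on {p 0..p n}" "\<And>j. j < n \<Longrightarrow> p j \<le> p (Suc j)"
  shows "integral {p 0..p n} g = (\<Sum>j<n. integral {p j..p (Suc j)} g)"
  using assms
proof (induction n)
  case (Suc n)
  have "p 0 \<le> p j" if "j \<le> n" for j
    using that by (induction j) (use Suc.prems(2) in \<open>auto intro: order_trans\<close>)
  from this[of n] have "p 0 \<le> p n"
    by simp
  then have "integral {p 0..p n} g + integral {p n..p (Suc n)} g = integral {p 0..p (Suc n)} g"
    using Suc.prems by (intro Henstock_Kurzweil_Integration.integral_combine) auto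
  moreover have "g integrable_on {p 0..p n}"
    using Suc.prems by (intro integrable_on_subinterval[OF Suc.prems(1)]) auto
  ultimately show ?case
    using Suc by simp
qed simp

text \<open>The function \<open>h\<close> may change sign, so the error of freezing \<open>g\<close>
  on the cells is measured against the integral of \<open>\<bar>h x\<bar>\<close>.\<close>

lemma step_approximation_bound:
  fixes g h :: "real \<Rightarrow> real" and p \<beta> :: "nat \<Rightarrow> real"
  assumes h: "h integrable_on {p 0..p n}" and hg: "(\<lambda>x. g x * h x) integrable_on {p 0..p n}"
    and habs: "(\<lambda>x. \<bar>h x\<bar>) integrable_on {p 0..p n}"
    and p: "\<And>j. j < n \<Longrightarrow> p j \<le> p (Suc j)"
    and close: "\<And>j x. j < n \<Longrightarrow> x \<in> {p j..p (Suc j)} \<Longrightarrow> \<bar>g x - \<beta> j\<bar> \<le> e"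
  shows "\<bar>integral {p 0..p n} (\<lambda>x. g x * h x) - (\<Sum>j<n. \<beta> j * integral {p j..p (Suc j)} h)\<bar>
    \<le> e * integral {p 0..p n} (\<lambda>x. \<bar>h x\<bar>)"
proof -
  have mono: "p i \<le> p j" if "i \<le> j" "j \<le> n" for i j
    using that(1,2)
  proof (induction j rule: dec_induct)
    case (step j)
    then show ?case
      using p[of j] by simp
  qed simp
  have cell: "\<phi> integrable_on {p j..p (Suc j)}" if "\<phi> integrable_on {p 0..p n}" "j < n" for \<phi> :: "real \<Rightarrow> real" and j
    using that mono[of 0 j] mono[of "Suc j" n] by (intro integrable_on_subinterval[OF that(1)]) auto
  have "integral {p 0..p n} (\<lambda>x. g x * h x) - (\<Sum>j<n. \<beta> j * integral {p j..p (Suc j)} h)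
      = (\<Sum>j<n. integral {p j..p (Suc j)} (\<lambda>x. g x * h x) - \<beta> j * integral {p j..p (Suc j)} h)"
    using integral_sum_partition[OF hg p] by (simp add: sum_subtractf)
  also have "\<bar>\<dots>\<bar> \<le> (\<Sum>j<n. e * integral {p j..p (Suc j)} (\<lambda>x. \<bar>h x\<bar>))"
  proof (rule order_trans[OF sum_abs sum_mono])
    fix j
    assume "j \<in> {..<n}"
    then have j: "j < n"
      by simp
    let ?I = "{p j..p (Suc j)}"
    have "integral ?I (\<lambda>x. g x * h x) - \<beta> j * integral ?I h = integral ?I (\<lambda>x. g x * h x - \<beta> j * h x)"
      using cell[OF h j] cell[OF hg j] by (subst integral_diff) (auto intro: integrable_on_mult_right)
    also have "norm \<dots> \<le> integral ?I (\<lambda>x. e * \<bar>h x\<bar>)"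
    proof (rule integral_norm_bound_integral)
      show "(\<lambda>x. g x * h x - \<beta> j * h x) integrable_on ?I"
        using cell[OF h j] cell[OF hg j] by (intro integrable_diff integrable_on_mult_right)
      show "(\<lambda>x. e * \<bar>h x\<bar>) integrable_on ?I"
        using cell[OF habs j] by (intro integrable_on_mult_right)
      show "norm (g x * h x - \<beta> j * h x) \<le> e * \<bar>h x\<bar>" if "x \<in> ?I" for x
        using mult_right_mono[OF close[OF j that], of "\<bar>h x\<bar>"] by (simp add: left_diff_distrib flip: abs_mult)
    qed
    finally show "\<bar>integral ?I (\<lambda>x. g x * h x) - \<beta> j * integral ?I h\<bar> \<le> e * integral ?I (\<lambda>x. \<bar>h x\<bar>)"
      by simp
  qed
  also have "\<dots> = e * integral {p 0..p n} (\<lambda>x. \<bar>h x\<bar>)"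
    using integral_sum_partition[OF habs p] by (simp add: sum_distrib_left)
  finally show ?thesis .
qed

subsection \<open>Comparison of the convolution with weighted sums\<close>

lemma eventually_lil_scale_pos: "\<forall>\<^sub>F t in at_top. 0 < lil_scale t"
  unfolding lil_scale_def by real_asymp

lemma lil_scale_mono:
  assumes "exp 1 \<le> s" "s \<le> t"
  shows "lil_scale s \<le> lil_scale t"
proof -
  have "0 < s"
    using assms exp_gt_zero[of "1::real"] by linarith
  moreover have "1 \<le> ln s"
    using assms \<open>0 < s\<close> by (simp add: ln_ge_iff)
  moreover have "ln s \<le> ln t"
    using assms \<open>0 < s\<close> by simp
  moreover from this \<open>1 \<le> ln s\<close> have "ln (ln s) \<le> ln (ln t)"
    by (subst ln_le_cancel_iff) auto
  ultimately show ?thesis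
    unfolding lil_scale_def using assms by (intro real_sqrt_le_mono mult_mono) auto
qed

text \<open>There are two errors. Freezing \<open>b\<close> on the grid costs
  \<open>\<epsilon> / 4 * lil_scale t\<close> times the absolute integral of \<open>f'\<close>,
  which is eventually at most \<open>2 * f t\<close>. Replacing \<open>f (j / n * t) / f t\<close>
  by \<open>(j / n) powr \<alpha>\<close> costs the bound on \<open>b\<close> times finitely many
  quantities tending to 0. The first requires \<open>1 / n < \<delta>\<close>, the second a fixed
  \<open>n\<close>; hence the order of the quantifiers.\<close>

lemma convolution_approximation:
  fixes b f f' :: "real \<Rightarrow> real"
  assumes "0 < \<alpha>"
    and deriv: "\<And>x. 0 \<le> x \<Longrightarrow> (f has_real_derivative f' x) (at x within {0..})"
    and rv: "regularly_varying f' (\<alpha> - 1)"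
    and int: "\<And>t. 0 \<le> t \<Longrightarrow> set_integrable lborel {0..t} f'"
    and cont: "continuous_on {0..} b" and b0: "b 0 = 0" and equi: "lil_equicontinuous b"
    and "0 < \<epsilon>"
  shows "\<forall>\<^sub>F n in sequentially. \<forall>\<^sub>F t in at_top.
    \<bar>(LINT x:{0..t}|lborel. b (t - x) * f' x) / f t - weighted_increments \<alpha> n b t\<bar> \<le> \<epsilon> * lil_scale t"
proof -
  note f_top = regularly_varying_primitive_at_top[OF \<open>0 < \<alpha>\<close> deriv rv]
  note f_ratio = regularly_varying_primitive[OF \<open>0 < \<alpha>\<close> deriv rv]
  obtain T where T: "0 < T" "\<And>t. T \<le> t \<Longrightarrow> 0 < f' t"
  proof -
    have "\<forall>\<^sub>F t in at_top. 0 < t \<and> 0 < f' t"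
      using rv unfolding regularly_varying_def by (intro eventually_conj eventually_gt_at_top) auto
    then obtain T where "\<And>t. T \<le> t \<Longrightarrow> 0 < t \<and> 0 < f' t"
      unfolding eventually_at_top_linorder by blast
    then show ?thesis
      using that[of T] by blast
  qed
  have hk: "f' integrable_on {0..t}" and hk_abs: "(\<lambda>x. \<bar>f' x\<bar>) integrable_on {0..t}" if "0 \<le> t" for t
    using set_borel_integral_eq_integral(1)[OF int[OF that]]
      set_borel_integral_eq_integral(1)[OF set_integrable_abs[OF int[OF that]]] by auto
  have ftc: "integral {r..s} f' = f s - f r" if "0 \<le> r" "r \<le> s" for r s
  proof (rule integral_unique, rule fundamental_theorem_of_calculus[OF that(2)])
    fix x
    assume "x \<in> {r..s}"
    then show "(f has_vector_derivative f' x) (at x within {r..s})"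
      using that has_field_derivative_subset[OF deriv, of x "{r..s}"]
      by (auto simp: has_real_derivative_iff_has_vector_derivative)
  qed
  \<comment> \<open>Before \<open>T\<close> the sign of \<open>f'\<close> is unknown; the absolute
    integral up to there is a constant.\<close>
  define C where "C = integral {0..T} (\<lambda>x. \<bar>f' x\<bar>)"
  have mass: "integral {0..t} (\<lambda>x. \<bar>f' x\<bar>) = C + (f t - f T)" if "T \<le> t" for t
  proof -
    have "integral {0..T} (\<lambda>x. \<bar>f' x\<bar>) + integral {T..t} (\<lambda>x. \<bar>f' x\<bar>) = integral {0..t} (\<lambda>x. \<bar>f' x\<bar>)"
      using that T(1) hk_abs[of t] by (intro Henstock_Kurzweil_Integration.integral_combine) auto
    moreover have "integral {T..t} (\<lambda>x. \<bar>f' x\<bar>) = integral {T..t} f'"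
      using T(2) by (intro integral_cong) (auto simp: less_imp_le)
    ultimately show ?thesis
      using that T(1) by (simp add: C_def ftc)
  qed
  \<comment> \<open>Chosen so that \<open>C + (f t - f T) \<le> 2 * f t\<close>.\<close>
  have f_large: "\<forall>\<^sub>F t in at_top. 1 + \<bar>C - f T\<bar> \<le> f t"
    using f_top unfolding filterlim_at_top by blast
  obtain \<delta> where \<delta>: "\<delta> > 0" "\<forall>\<^sub>F t in at_top. \<forall>u\<in>{0..t}. \<forall>v\<in>{0..t}.
     \<bar>u - v\<bar> \<le> \<delta> * t \<longrightarrow> \<bar>b u - b v\<bar> \<le> \<epsilon> / 4 * lil_scale t"
    using equi \<open>0 < \<epsilon>\<close> unfolding lil_equicontinuous_def
    by (meson divide_pos_pos zero_less_numeral)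
  obtain K where K: "K \<ge> 0" "\<forall>\<^sub>F t in at_top. \<forall>u\<in>{0..t}. \<bar>b u\<bar> \<le> K * lil_scale t"
    using lil_equicontinuous_bounded[OF equi b0] by blast
  have "\<forall>\<^sub>F n in sequentially. 1 / real n < \<delta>"
    using \<open>0 < \<delta>\<close> by real_asymp
  then show ?thesis
    using eventually_gt_at_top[of 0]
  proof eventually_elim
    case (elim n)
    define e where "e j t = f (real j / real n * t) / f t - (real j / real n) powr \<alpha>" for j t
    have "((\<lambda>t. e j t) \<longlongrightarrow> 0) at_top" for j
      unfolding e_def using f_ratio[of "real j / real n"] by (intro LIM_zero) simp
    then have "((\<lambda>t. K * (\<Sum>j<n. \<bar>e (Suc j) t - e j t\<bar>)) \<longlongrightarrow> K * (\<Sum>j<n. \<bar>0 - 0\<bar>)) at_top"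
      by (intro tendsto_intros)
    then have "\<forall>\<^sub>F t in at_top. K * (\<Sum>j<n. \<bar>e (Suc j) t - e j t\<bar>) < \<epsilon> / 2"
      using \<open>0 < \<epsilon>\<close> by (intro order_tendstoD(2)[where y="K * (\<Sum>j<n. \<bar>0 - 0\<bar>)"]) auto
    then show ?case
      using \<delta>(2) K(2) f_large eventually_ge_at_top[of T] eventually_lil_scale_pos
    proof eventually_elim
      case (elim t)
      have t: "0 < t" "0 < f t"
        using elim T by auto
      define p where "p j = real j / real n * t" for j
      define \<beta> where "\<beta> j = b (t * (real (n - j) / real n))" for j
      have \<beta>: "\<beta> j = b (t - p j)" if "j < n" for j
        using that by (simp add: \<beta>_def p_def of_nat_diff diff_divide_distrib algebra_simps)
      have p_ends: "p 0 = 0" "p n = t"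
        using \<open>0 < n\<close> by (simp_all add: p_def)
      have p_step: "p (Suc j) = p j + t / real n" for j
        by (simp add: p_def add_divide_distrib algebra_simps)
      have p_bounds: "0 \<le> p j" "j \<le> n \<Longrightarrow> p j \<le> t" for j
        using t mult_right_mono[of "real j / real n" 1 t] \<open>0 < n\<close> by (auto simp: p_def)
      have \<beta>_bound: "\<bar>\<beta> j\<bar> \<le> K * lil_scale t" if "j < n" for j
        using elim p_bounds[of j] that by (simp add: \<beta>)
      note int_prod = set_integrable_reflected_mult[OF cont int[OF less_imp_le[OF t(1)]]]
      let ?X = "LINT x:{0..t}|lborel. b (t - x) * f' x"
      have "\<bar>integral {p 0..p n} (\<lambda>x. b (t - x) * f' x) - (\<Sum>j<n. \<beta> j * integral {p j..p (Suc j)} f')\<bar>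
          \<le> \<epsilon> / 4 * lil_scale t * integral {p 0..p n} (\<lambda>x. \<bar>f' x\<bar>)"
      proof (rule step_approximation_bound)
        show "f' integrable_on {p 0..p n}" "(\<lambda>x. \<bar>f' x\<bar>) integrable_on {p 0..p n}"
          "(\<lambda>x. b (t - x) * f' x) integrable_on {p 0..p n}"
          unfolding p_ends using t hk hk_abs set_borel_integral_eq_integral(1)[OF int_prod] by auto
        show "p j \<le> p (Suc j)" for j
          using t by (simp add: p_step)
        show "\<bar>b (t - x) - \<beta> j\<bar> \<le> \<epsilon> / 4 * lil_scale t" if j: "j < n" and x: "x \<in> {p j..p (Suc j)}" for j x
        proof -
          have "t - x \<in> {0..t}" "t - p j \<in> {0..t}"
            using x p_bounds[of j] p_bounds[of "Suc j"] j by auto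
          moreover have "\<bar>(t - x) - (t - p j)\<bar> \<le> \<delta> * t"
          proof -
            have "\<bar>(t - x) - (t - p j)\<bar> \<le> t * (1 / real n)"
              using x by (auto simp: p_step)
            also have "\<dots> \<le> t * \<delta>"
              using t \<open>1 / real n < \<delta>\<close> by (intro mult_left_mono) auto
            finally show ?thesis
              by (simp add: mult.commute)
          qed
          ultimately show ?thesis
            using elim j by (simp add: \<beta>)
        qed
      qed
      also have "integral {p 0..p n} (\<lambda>x. b (t - x) * f' x) = ?X"
        unfolding p_ends by (rule set_borel_integral_eq_integral(2)[OF int_prod, symmetric])
      also have "(\<Sum>j<n. \<beta> j * integral {p j..p (Suc j)} f') = (\<Sum>j<n. \<beta> j * (f (p (Suc j)) - f (p j)))"
        using p_bounds t by (intro sum.cong refl) (simp add: ftc p_step)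
      also have "\<epsilon> / 4 * lil_scale t * integral {p 0..p n} (\<lambda>x. \<bar>f' x\<bar>) \<le> \<epsilon> / 4 * lil_scale t * (2 * f t)"
        unfolding p_ends using elim mass[of t] \<open>0 < \<epsilon>\<close> by (intro mult_left_mono) auto
      finally have "\<bar>?X - (\<Sum>j<n. \<beta> j * (f (p (Suc j)) - f (p j)))\<bar> \<le> \<epsilon> / 2 * lil_scale t * f t"
        by (simp add: mult_ac)
      then have "\<bar>?X - (\<Sum>j<n. \<beta> j * (f (p (Suc j)) - f (p j)))\<bar> / f t \<le> \<epsilon> / 2 * lil_scale t"
        using t by (simp add: pos_divide_le_eq)
      then have X: "\<bar>?X / f t - (\<Sum>j<n. \<beta> j * (f (p (Suc j)) - f (p j))) / f t\<bar> \<le> \<epsilon> / 2 * lil_scale t"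
        using t by (simp flip: diff_divide_distrib)
      have "(\<Sum>j<n. \<beta> j * (f (p (Suc j)) - f (p j))) / f t - weighted_increments \<alpha> n b t
          = (\<Sum>j<n. \<beta> j * (e (Suc j) t - e j t))"
        unfolding weighted_increments_abel[of n b, OF \<open>0 < n\<close> b0] sum_divide_distrib sum_subtractf[symmetric]
        by (intro sum.cong refl)
           (simp add: e_def p_def \<beta>_def algebra_simps diff_divide_distrib del: of_nat_Suc)
      also have "\<bar>\<dots>\<bar> \<le> (\<Sum>j<n. K * lil_scale t * \<bar>e (Suc j) t - e j t\<bar>)"
        by (rule order_trans[OF sum_abs sum_mono]) (use \<beta>_bound in \<open>auto simp: abs_mult intro: mult_right_mono\<close>)
      also have "\<dots> = K * (\<Sum>j<n. \<bar>e (Suc j) t - e j t\<bar>) * lil_scale t"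
        by (simp add: sum_distrib_left sum_distrib_right mult_ac)
      also have "\<dots> \<le> \<epsilon> / 2 * lil_scale t"
        using elim by (intro mult_right_mono) auto
      finally show ?case
        using X by linarith
    qed
  qed
qed

subsection \<open>Limit points\<close>

text \<open>After summation by parts the weights \<open>v j\<close> are nonnegative with sum 1, so
  the sum is an average of values \<open>b (t * x)\<close> and moves no more than the path
  does.\<close>

lemma weighted_increments_dist_le:
  assumes "0 < n" "0 \<le> \<alpha>" "b 0 = 0"
    and close: "\<And>x. x \<in> {0..1} \<Longrightarrow> \<bar>b (t * x) - b (s * x)\<bar> \<le> e"
  shows "\<bar>weighted_increments \<alpha> n b t - weighted_increments \<alpha> n b s\<bar> \<le> e"
proof -
  define v where "v j = (real (Suc j) / real n) powr \<alpha> - (real j / real n) powr \<alpha>" for j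
  have v_nonneg: "0 \<le> v j" for j
    using assms by (auto simp: v_def intro!: powr_mono2 divide_right_mono)
  have "0 \<le> e"
    using close[of 0] by simp
  have "weighted_increments \<alpha> n b t - weighted_increments \<alpha> n b s =
      (\<Sum>j<n. (b (t * (real (n - j) / real n)) - b (s * (real (n - j) / real n))) * v j)"
    unfolding weighted_increments_abel[of n b, OF \<open>0 < n\<close> \<open>b 0 = 0\<close>] v_def
    by (simp add: sum_subtractf left_diff_distrib del: of_nat_Suc)
  also have "\<bar>\<dots>\<bar> \<le> (\<Sum>j<n. e * v j)"
  proof (rule order_trans[OF sum_abs sum_mono])
    fix j
    show "\<bar>(b (t * (real (n - j) / real n)) - b (s * (real (n - j) / real n))) * v j\<bar> \<le> e * v j"
      using close[of "real (n - j) / real n"] v_nonneg[of j] \<open>0 < n\<close>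
      by (auto simp: abs_mult intro!: mult_right_mono)
  qed
  also have "\<dots> = e * (\<Sum>j<n. v j)"
    by (simp add: sum_distrib_left)
  also have "(\<Sum>j<n. v j) = 1 - 0 powr \<alpha>"
    unfolding v_def using \<open>0 < n\<close> by (subst sum_lessThan_telescope[where f="\<lambda>j. (real j / real n) powr \<alpha>"]) simp
  also have "e * (1 - 0 powr \<alpha>) \<le> e"
    using \<open>0 \<le> e\<close> by (simp add: mult_left_le)
  finally show ?thesis .
qed

lemma frequently_at_top_dense:
  fixes P :: "real \<Rightarrow> bool"
  shows "(\<exists>\<^sub>F t in at_top. P t) \<longleftrightarrow> (\<forall>N. \<exists>t>N. P t)"
  unfolding frequently_def eventually_at_top_dense by blast

lemma frequently_compose_filterlim:
  assumes "\<exists>\<^sub>F k in F. P (g k)" "filterlim g G F"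
  shows "\<exists>\<^sub>F t in G. P t"
  using assms eventually_compose_filterlim[of "\<lambda>t. \<not> P t" G g F] unfolding frequently_def by blast

text \<open>The law of the iterated logarithm for the approximating sums along geometric sequences, as a
  property of a single path.\<close>

definition lil_path :: "real \<Rightarrow> (real \<Rightarrow> real) \<Rightarrow> bool" where
  "lil_path \<alpha> b \<longleftrightarrow> b 0 = 0 \<and> continuous_on {0..} b \<and> lil_equicontinuous b \<and>
     (\<forall>n\<ge>2. \<forall>\<^sub>F k in sequentially.
        \<bar>weighted_increments \<alpha> n b ((1 + 1 / real n) ^ k)\<bar>
          \<le> (sqrt (weight_variance \<alpha> n) + 1 / real n) * lil_scale ((1 + 1 / real n) ^ k)) \<and>
     (\<forall>n\<ge>2. \<forall>c\<in>{1, -1}. \<exists>\<^sub>F k in sequentially.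
        c * (weighted_increments \<alpha> n b (real n ^ Suc k) - (b (real n ^ k) - b 0))
          > (sqrt (weight_variance \<alpha> n - 1 / real n) - 1 / real n) * lil_scale (real n ^ Suc k))"

text \<open>The slack \<open>1 / n\<close> in both bounds vanishes as \<open>n\<close> grows, so
  countably many null sets cover every precision needed later.\<close>

lemma (in standard_brownian_motion) lil_path_AE: "AE \<omega> in M. lil_path \<alpha> (\<lambda>u. B u \<omega>)"
proof -
  have upper: "AE \<omega> in M. \<forall>n\<ge>2. \<forall>\<^sub>F k in sequentially.
        \<bar>weighted_increments \<alpha> n (\<lambda>u. B u \<omega>) ((1 + 1 / real n) ^ k)\<bar>
          \<le> (sqrt (weight_variance \<alpha> n) + 1 / real n) * lil_scale ((1 + 1 / real n) ^ k)"
    unfolding AE_all_countable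
  proof
    fix n :: nat
    show "AE \<omega> in M. 2 \<le> n \<longrightarrow> (\<forall>\<^sub>F k in sequentially.
        \<bar>weighted_increments \<alpha> n (\<lambda>u. B u \<omega>) ((1 + 1 / real n) ^ k)\<bar>
          \<le> (sqrt (weight_variance \<alpha> n) + 1 / real n) * lil_scale ((1 + 1 / real n) ^ k))"
    proof (cases "2 \<le> n")
      case True
      then show ?thesis
        using weighted_increments_upper_AE[OF True, of "1 + 1 / real n" \<alpha> "sqrt (weight_variance \<alpha> n) + 1 / real n"]
        by simp
    qed simp
  qed
  have lower: "AE \<omega> in M. \<forall>n\<ge>2. \<forall>c\<in>{1, -1}. \<exists>\<^sub>F k in sequentially.
        c * (weighted_increments \<alpha> n (\<lambda>u. B u \<omega>) (real n ^ Suc k) - (B (real n ^ k) \<omega> - B 0 \<omega>))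
          > (sqrt (weight_variance \<alpha> n - 1 / real n) - 1 / real n) * lil_scale (real n ^ Suc k)"
    unfolding AE_all_countable
  proof
    fix n :: nat
    show "AE \<omega> in M. 2 \<le> n \<longrightarrow> (\<forall>c\<in>{1, -1}. \<exists>\<^sub>F k in sequentially.
        c * (weighted_increments \<alpha> n (\<lambda>u. B u \<omega>) (real n ^ Suc k) - (B (real n ^ k) \<omega> - B 0 \<omega>))
          > (sqrt (weight_variance \<alpha> n - 1 / real n) - 1 / real n) * lil_scale (real n ^ Suc k))"
    proof (cases "2 \<le> n")
      case True
      let ?a = "sqrt (weight_variance \<alpha> n - 1 / real n) - 1 / real n"
      have "?a < sqrt (weight_variance \<alpha> n - 1 / real n)"
        using True by simp
      from weighted_increments_lower_AE[OF True this, of 1] weighted_increments_lower_AE[OF True this, of "-1"]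
      show ?thesis
        by (auto simp del: power_Suc)
    qed simp
  qed
  from start_zero continuous_paths lil_equicontinuous_AE upper lower show ?thesis
    by eventually_elim (simp add: lil_path_def)
qed

section \<open>The range of the weighted sums along one path\<close>

text \<open>Grid and ratio share the same \<open>n\<close>: every large \<open>t\<close> lies within
  relative distance \<open>1 / n < \<delta>\<close> above some \<open>q ^ k\<close>, and the
  averaging property carries the bound from \<open>q ^ k\<close> to \<open>t\<close> at the cost of
  \<open>\<epsilon> / 2\<close>.\<close>

lemma lil_path_weighted_increments_le:
  assumes "lil_path \<alpha> b" "0 < \<alpha>" "0 < \<epsilon>"
  shows "\<forall>\<^sub>F n in sequentially. \<forall>\<^sub>F t in at_top.
    \<bar>weighted_increments \<alpha> n b t\<bar> \<le> (1 / sqrt (2 * \<alpha> + 1) + \<epsilon>) * lil_scale t"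
proof -
  have b0: "b 0 = 0" and equi: "lil_equicontinuous b"
    and upper: "\<And>n. 2 \<le> n \<Longrightarrow> \<forall>\<^sub>F k in sequentially.
        \<bar>weighted_increments \<alpha> n b ((1 + 1 / real n) ^ k)\<bar>
          \<le> (sqrt (weight_variance \<alpha> n) + 1 / real n) * lil_scale ((1 + 1 / real n) ^ k)"
    using assms(1) unfolding lil_path_def by blast+
  obtain \<delta> where \<delta>: "\<delta> > 0" "\<forall>\<^sub>F t in at_top. \<forall>u\<in>{0..t}. \<forall>v\<in>{0..t}.
     \<bar>u - v\<bar> \<le> \<delta> * t \<longrightarrow> \<bar>b u - b v\<bar> \<le> \<epsilon> / 2 * lil_scale t"
    using equi \<open>0 < \<epsilon>\<close> unfolding lil_equicontinuous_def by (meson half_gt_zero)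
  have "(\<lambda>n. sqrt (weight_variance \<alpha> n) + 1 / real n) \<longlonglongrightarrow> sqrt (1 / (2 * \<alpha> + 1)) + 0"
    by (intro tendsto_intros weight_variance_tendsto \<open>0 < \<alpha>\<close> lim_1_over_n)
  then have "\<forall>\<^sub>F n in sequentially. sqrt (weight_variance \<alpha> n) + 1 / real n < 1 / sqrt (2 * \<alpha> + 1) + \<epsilon> / 2"
    using \<open>0 < \<epsilon>\<close> by (intro order_tendstoD(2)) (auto simp: real_sqrt_divide)
  moreover have "\<forall>\<^sub>F n in sequentially. 1 / real n < \<delta>"
    using \<open>0 < \<delta>\<close> by real_asymp
  ultimately show ?thesis
    using eventually_ge_at_top[of 2]
  proof eventually_elim
    case (elim n)
    define q where "q = 1 + 1 / real n"
    have q: "1 < q"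
      using elim by (simp add: q_def)
    obtain N where N: "\<And>k. N \<le> k \<Longrightarrow>
        \<bar>weighted_increments \<alpha> n b (q ^ k)\<bar> \<le> (sqrt (weight_variance \<alpha> n) + 1 / real n) * lil_scale (q ^ k)"
      using upper[OF \<open>2 \<le> n\<close>] unfolding q_def eventually_sequentially by blast
    have "filterlim (\<lambda>k. q ^ k) at_top sequentially"
      using q by real_asymp
    then have "\<forall>\<^sub>F k in sequentially. exp 1 \<le> q ^ k"
      unfolding filterlim_at_top by blast
    then obtain N' where N': "\<And>k. N' \<le> k \<Longrightarrow> exp 1 \<le> q ^ k"
      unfolding eventually_sequentially by blast
    show ?case
      using \<delta>(2) eventually_ge_at_top[of "q ^ max N N'"] eventually_lil_scale_pos
    proof eventually_elim
      case (elim t)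
      have "1 \<le> q ^ max N N'"
        using q by (intro one_le_power) auto
      then have "1 \<le> t"
        using elim by linarith
      define k where "k = nat \<lfloor>log q t\<rfloor>"
      have "0 \<le> log q t"
        using q \<open>1 \<le> t\<close> by simp
      then have k: "real k \<le> log q t" "log q t < real k + 1"
        by (simp_all add: k_def)
      have "real (max N N') \<le> log q t"
        using elim q \<open>1 \<le> t\<close> by (simp add: le_log_iff powr_realpow)
      then have "max N N' \<le> k"
        using k by linarith
      have qk: "q ^ k \<le> t" "t \<le> q ^ k * q"
      proof -
        show "q ^ k \<le> t"
          using k(1) q \<open>1 \<le> t\<close> by (simp add: le_log_iff powr_realpow)
        have "t \<le> q powr (real k + 1)"
          using k(2) q \<open>1 \<le> t\<close> by (simp add: log_less_iff)
        then show "t \<le> q ^ k * q"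
          using q by (simp add: powr_realpow powr_add)
      qed
      have "\<bar>b (t * x) - b (q ^ k * x)\<bar> \<le> \<epsilon> / 2 * lil_scale t" if x: "x \<in> {0..1}" for x
      proof -
        have "0 < q ^ k"
          using q by simp
        have "t * x \<le> t" "0 \<le> q ^ k * x" "q ^ k * x \<le> t * x"
          using x qk \<open>1 \<le> t\<close> \<open>0 < q ^ k\<close> by (auto intro!: mult_left_le mult_right_mono)
        moreover have "(t - q ^ k) * x \<le> \<delta> * t"
        proof -
          have "t - q ^ k \<le> q ^ k * (1 / real n)"
            using qk by (simp add: q_def distrib_left)
          also have "\<dots> \<le> t * \<delta>"
            using qk \<open>1 / real n < \<delta>\<close> \<open>1 \<le> t\<close> by (intro mult_mono) auto
          finally have "t - q ^ k \<le> t * \<delta>" .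
          moreover have "(t - q ^ k) * x \<le> (t - q ^ k) * 1"
            using x qk by (intro mult_left_mono) auto
          ultimately show ?thesis
            by (simp add: mult.commute)
        qed
        ultimately have "t * x \<in> {0..t}" "q ^ k * x \<in> {0..t}" "\<bar>t * x - q ^ k * x\<bar> \<le> \<delta> * t"
          by (auto simp: left_diff_distrib)
        with elim show ?thesis
          by blast
      qed
      then have "\<bar>weighted_increments \<alpha> n b t - weighted_increments \<alpha> n b (q ^ k)\<bar> \<le> \<epsilon> / 2 * lil_scale t"
        using \<open>2 \<le> n\<close> \<open>0 < \<alpha>\<close> b0 by (intro weighted_increments_dist_le) auto
      moreover have "\<bar>weighted_increments \<alpha> n b (q ^ k)\<bar> \<le> (1 / sqrt (2 * \<alpha> + 1) + \<epsilon> / 2) * lil_scale t"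
      proof -
        have "\<bar>weighted_increments \<alpha> n b (q ^ k)\<bar> \<le> (sqrt (weight_variance \<alpha> n) + 1 / real n) * lil_scale (q ^ k)"
          using N \<open>max N N' \<le> k\<close> by simp
        also have "\<dots> \<le> (1 / sqrt (2 * \<alpha> + 1) + \<epsilon> / 2) * lil_scale t"
        proof (rule mult_mono')
          show "lil_scale (q ^ k) \<le> lil_scale t"
            using N'[of k] \<open>max N N' \<le> k\<close> qk by (intro lil_scale_mono) auto
          have e: "exp 1 \<le> q ^ k"
            using N'[of k] \<open>max N N' \<le> k\<close> by simp
          then have "1 \<le> ln (q ^ k)"
            using q by (subst ln_ge_iff) auto
          then show "0 \<le> lil_scale (q ^ k)"
            using q unfolding lil_scale_def by (intro real_sqrt_ge_zero mult_nonneg_nonneg) auto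
          show "0 \<le> sqrt (weight_variance \<alpha> n) + 1 / real n"
            by (auto simp: weight_variance_def intro!: add_nonneg_nonneg sum_nonneg divide_nonneg_nonneg)
        qed (use \<open>sqrt (weight_variance \<alpha> n) + 1 / real n < _\<close> in simp)
        finally show ?thesis .
      qed
      ultimately have "\<bar>weighted_increments \<alpha> n b t\<bar>
          \<le> \<epsilon> / 2 * lil_scale t + (1 / sqrt (2 * \<alpha> + 1) + \<epsilon> / 2) * lil_scale t"
        by linarith
      then show ?case
        by (simp add: distrib_right)
    qed
  qed
qed

text \<open>Divided by the scale, the sum comes near both extremes at arbitrarily large
  \<open>t\<close>; a value between them that is avoided on a half-line would disconnect the image
  of a connected set. The hits are exact, and one \<open>n\<close> serves all
  \<open>v\<close>.\<close>

lemma lil_path_weighted_increments_hits: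
  assumes "lil_path \<alpha> b" "0 < \<alpha>" "0 < \<epsilon>" "\<epsilon> < 1 / sqrt (2 * \<alpha> + 1)"
  shows "\<forall>\<^sub>F n in sequentially. \<forall>v. \<bar>v\<bar> \<le> 1 / sqrt (2 * \<alpha> + 1) - \<epsilon> \<longrightarrow>
    (\<exists>\<^sub>F t in at_top. weighted_increments \<alpha> n b t = v * lil_scale t)"
proof -
  let ?\<sigma> = "1 / sqrt (2 * \<alpha> + 1)"
  have b0: "b 0 = 0" and equi: "lil_equicontinuous b" and cont: "continuous_on {0..} b"
    and lower: "\<And>n c. 2 \<le> n \<Longrightarrow> c \<in> {1, -1} \<Longrightarrow> \<exists>\<^sub>F k in sequentially.
        c * (weighted_increments \<alpha> n b (real n ^ Suc k) - (b (real n ^ k) - b 0))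
          > (sqrt (weight_variance \<alpha> n - 1 / real n) - 1 / real n) * lil_scale (real n ^ Suc k)"
    using assms(1) unfolding lil_path_def by blast+
  obtain \<delta> where \<delta>: "\<delta> > 0" "\<forall>\<^sub>F t in at_top. \<forall>u\<in>{0..t}. \<forall>v\<in>{0..t}.
     \<bar>u - v\<bar> \<le> \<delta> * t \<longrightarrow> \<bar>b u - b v\<bar> \<le> \<epsilon> / 2 * lil_scale t"
    using equi \<open>0 < \<epsilon>\<close> unfolding lil_equicontinuous_def by (meson half_gt_zero)
  have "(\<lambda>n. sqrt (weight_variance \<alpha> n - 1 / real n) - 1 / real n) \<longlonglongrightarrow> sqrt (1 / (2 * \<alpha> + 1) - 0) - 0"
    by (intro tendsto_intros weight_variance_tendsto \<open>0 < \<alpha>\<close> lim_1_over_n)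
  then have "\<forall>\<^sub>F n in sequentially. ?\<sigma> - \<epsilon> / 2 < sqrt (weight_variance \<alpha> n - 1 / real n) - 1 / real n"
    using \<open>0 < \<epsilon>\<close> by (intro order_tendstoD(1)) (auto simp: real_sqrt_divide)
  moreover have "\<forall>\<^sub>F n in sequentially. 1 / real n < \<delta>"
    using \<open>0 < \<delta>\<close> by real_asymp
  ultimately show ?thesis
    using eventually_ge_at_top[of 2]
  proof eventually_elim
    case (elim n)
    let ?h = "\<lambda>t. weighted_increments \<alpha> n b t / lil_scale t"
    have extreme: "\<exists>\<^sub>F t in at_top. ?\<sigma> - \<epsilon> \<le> c * ?h t" if c: "c \<in> {1, -1}" for c
    proof -
      have top: "filterlim (\<lambda>k. real n ^ Suc k) at_top sequentially"
        using \<open>2 \<le> n\<close> by real_asymp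
      \<comment> \<open>The increment removed for independence spans the fraction
        \<open>1 / n < \<delta>\<close> of \<open>{0..n ^ Suc k}\<close>, so the modulus makes it
        small.\<close>
      have "\<forall>\<^sub>F k in sequentially. \<bar>b (real n ^ k)\<bar> \<le> \<epsilon> / 2 * lil_scale (real n ^ Suc k) \<and> 0 < lil_scale (real n ^ Suc k)"
        using eventually_compose_filterlim[OF \<delta>(2) top] eventually_compose_filterlim[OF eventually_lil_scale_pos top]
      proof eventually_elim
        case (elim k)
        have "real n ^ k = real n ^ Suc k * (1 / real n)"
          using \<open>2 \<le> n\<close> by simp
        also have "\<dots> \<le> real n ^ Suc k * \<delta>"
          using \<open>1 / real n < \<delta>\<close> by (intro mult_left_mono) auto
        finally have "\<bar>real n ^ k - 0\<bar> \<le> \<delta> * real n ^ Suc k"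
          by (simp add: mult.commute)
        moreover have "real n ^ k \<in> {0..real n ^ Suc k}" "0 \<in> {0..real n ^ Suc k}"
          using \<open>2 \<le> n\<close> by auto
        ultimately have "\<bar>b (real n ^ k) - b 0\<bar> \<le> \<epsilon> / 2 * lil_scale (real n ^ Suc k)"
          using elim(1) by blast
        then show ?case
          using elim(2) b0 by simp
      qed
      from frequently_eventually_frequently[OF lower[OF \<open>2 \<le> n\<close> c] this]
      have "\<exists>\<^sub>F k in sequentially. ?\<sigma> - \<epsilon> \<le> c * ?h (real n ^ Suc k)"
      proof (rule frequently_elim1)
        fix k
        let ?t = "real n ^ Suc k"
        assume *: "(sqrt (weight_variance \<alpha> n - 1 / real n) - 1 / real n) * lil_scale ?t
            < c * (weighted_increments \<alpha> n b ?t - (b (real n ^ k) - b 0)) \<and>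
          \<bar>b (real n ^ k)\<bar> \<le> \<epsilon> / 2 * lil_scale ?t \<and> 0 < lil_scale ?t"
        have "(?\<sigma> - \<epsilon> / 2) * lil_scale ?t \<le> (sqrt (weight_variance \<alpha> n - 1 / real n) - 1 / real n) * lil_scale ?t"
          using * \<open>?\<sigma> - \<epsilon> / 2 < _\<close> by (intro mult_right_mono) auto
        also have "\<dots> \<le> c * weighted_increments \<alpha> n b ?t + \<bar>b (real n ^ k)\<bar>"
          using * c b0 by (auto simp del: power_Suc)
        also have "\<dots> \<le> c * weighted_increments \<alpha> n b ?t + \<epsilon> / 2 * lil_scale ?t"
          using * by simp
        finally have "(?\<sigma> - \<epsilon>) * lil_scale ?t \<le> c * weighted_increments \<alpha> n b ?t"
          by (simp add: left_diff_distrib del: power_Suc)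
        then show "?\<sigma> - \<epsilon> \<le> c * ?h ?t"
          using * by (simp add: pos_le_divide_eq del: power_Suc)
      qed
      then show ?thesis
        by (rule frequently_compose_filterlim[OF _ top])
    qed
    show ?case
    proof (intro allI impI)
      fix v
      assume v: "\<bar>v\<bar> \<le> ?\<sigma> - \<epsilon>"
      show "\<exists>\<^sub>F t in at_top. weighted_increments \<alpha> n b t = v * lil_scale t"
        unfolding frequently_def
      proof
        assume never: "\<forall>\<^sub>F t in at_top. \<not> weighted_increments \<alpha> n b t = v * lil_scale t"
        have "\<forall>\<^sub>F t in at_top. weighted_increments \<alpha> n b t \<noteq> v * lil_scale t \<and> 0 < lil_scale t \<and> exp 1 < t"
          using never eventually_lil_scale_pos eventually_gt_at_top[of "exp 1"]
          by eventually_elim auto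
        then obtain T where T: "\<And>t. T \<le> t \<Longrightarrow>
            weighted_increments \<alpha> n b t \<noteq> v * lil_scale t \<and> 0 < lil_scale t \<and> exp 1 < t"
          unfolding eventually_at_top_linorder by blast
        obtain t1 where t1: "T \<le> t1" "?\<sigma> - \<epsilon> \<le> 1 * ?h t1"
          using extreme[of 1] unfolding frequently_at_top_dense by (meson insertI1 less_imp_le)
        obtain t2 where t2: "T \<le> t2" "?\<sigma> - \<epsilon> \<le> -1 * ?h t2"
          using extreme[of "-1"] unfolding frequently_at_top_dense by (meson insertI1 insertI2 less_imp_le)
        \<comment> \<open>Beyond \<open>T\<close>, the bound \<open>exp 1 < t\<close> gives
          \<open>ln t > 1\<close>, so that both logarithms in \<open>lil_scale\<close> are
          continuous.\<close>
        have "continuous_on {T..} ?h"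
        proof (intro continuous_on_divide)
          have pos: "0 < t" "1 < ln t" if "T \<le> t" for t
          proof -
            show "0 < t"
              using T[OF that] exp_gt_zero[of "1::real"] by linarith
            then show "1 < ln t"
              using T[OF that] by (subst exp_less_cancel_iff[symmetric]) simp
          qed
          have *: "continuous_on {T..} (\<lambda>t. b (t * c))" if "0 \<le> c" for c
            using pos(1)[of T] that by (intro continuous_on_compose2[OF cont] continuous_intros) auto
          show "continuous_on {T..} (\<lambda>t. weighted_increments \<alpha> n b t)"
            unfolding weighted_increments_def by (intro continuous_intros *) auto
          have "t \<noteq> 0" "ln t \<noteq> 0" if "t \<in> {T..}" for t
            using pos[of t] that by auto
          then show "continuous_on {T..} lil_scale"
            unfolding lil_scale_def by (intro continuous_intros) auto
          show "\<forall>t\<in>{T..}. lil_scale t \<noteq> 0"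
            using T by fastforce
        qed
        then have "connected (?h ` {T..})"
          by (intro connected_continuous_image) auto
        moreover have "?h t2 \<le> v" "v \<le> ?h t1"
          using v t1 t2 by auto
        ultimately have "v \<in> ?h ` {T..}"
          using t1 t2 by (meson atLeast_iff connectedD_interval imageI)
        then obtain t where "T \<le> t" "v = ?h t"
          by auto
        then show False
          using T[of t] nonzero_eq_divide_eq[of "lil_scale t" v] by auto
      qed
    qed
  qed
qed

lemma limit_pointI:
  assumes "\<And>\<epsilon>. 0 < \<epsilon> \<Longrightarrow> \<exists>\<^sub>F t in at_top. \<bar>x t - y\<bar> \<le> \<epsilon>"
  shows "y \<in> limit_points {a<..} x"
proof -
  have "\<exists>t. max a (real n) < t \<and> \<bar>x t - y\<bar> \<le> 1 / real (Suc n)" for n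
  proof -
    have "\<exists>\<^sub>F t in at_top. \<bar>x t - y\<bar> \<le> 1 / real (Suc n)"
      by (rule assms) simp
    then show ?thesis
      unfolding frequently_at_top_dense by blast
  qed
  then obtain s where s: "\<And>n. max a (real n) < s n \<and> \<bar>x (s n) - y\<bar> \<le> 1 / real (Suc n)"
    by metis
  have "filterlim s at_top sequentially"
    using s by (intro filterlim_at_top_mono[OF filterlim_real_sequentially]) (auto simp: less_imp_le)
  moreover have "(\<lambda>n. x (s n) - y) \<longlonglongrightarrow> 0"
  proof (rule Lim_null_comparison)
    show "\<forall>\<^sub>F n in sequentially. norm (x (s n) - y) \<le> 1 / real (Suc n)"
      using s by auto
    show "(\<lambda>n. 1 / real (Suc n)) \<longlonglongrightarrow> 0"
      by real_asymp
  qed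
  then have "(\<lambda>n. x (s n)) \<longlonglongrightarrow> y"
    by (rule LIM_zero_cancel)
  ultimately show ?thesis
    using s by (auto simp: limit_points_def)
qed

lemma limit_point_abs_le:
  assumes "y \<in> limit_points I x" "\<forall>\<^sub>F t in at_top. \<bar>x t\<bar> \<le> C"
  shows "\<bar>y\<bar> \<le> C"
proof -
  obtain s :: "nat \<Rightarrow> real" where s: "filterlim s at_top sequentially" "(\<lambda>n. x (s n)) \<longlonglongrightarrow> y"
    using assms by (auto simp: limit_points_def)
  from s(2) have "(\<lambda>n. \<bar>x (s n)\<bar>) \<longlonglongrightarrow> \<bar>y\<bar>"
    by (rule tendsto_rabs)
  then show ?thesis
    using eventually_compose_filterlim[OF assms(2) s(1)] by (rule tendsto_upperbound) simp
qed

text \<open>Only large \<open>t\<close> matter for limit points, so the left end \<open>a\<close> of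
  the index set is arbitrary. Division by \<open>\<sigma> * lil_scale t\<close> turns the range
  between \<open>- \<sigma>\<close> and \<open>\<sigma>\<close> into \<open>{-1..1}\<close>.\<close>

lemma lil_path_limit_points:
  fixes b f f' :: "real \<Rightarrow> real"
  assumes "0 < \<alpha>"
    and deriv: "\<And>x. 0 \<le> x \<Longrightarrow> (f has_real_derivative f' x) (at x within {0..})"
    and rv: "regularly_varying f' (\<alpha> - 1)"
    and int: "\<And>t. 0 \<le> t \<Longrightarrow> set_integrable lborel {0..t} f'"
    and path: "lil_path \<alpha> b"
  shows "limit_points {a<..}
      (\<lambda>t. (LINT x:{0..t}|lborel. b (t - x) * f' x) /
            (sqrt (2 * inverse (2 * \<alpha> + 1) * t * ln (ln t)) * f t)) = {-1..1}"
proof -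
  define \<sigma> where "\<sigma> = 1 / sqrt (2 * \<alpha> + 1)"
  have "0 < \<sigma>"
    using assms by (simp add: \<sigma>_def)
  define X where "X t = (LINT x:{0..t}|lborel. b (t - x) * f' x) / f t" for t
  have ratio: "(LINT x:{0..t}|lborel. b (t - x) * f' x) /
      (sqrt (2 * inverse (2 * \<alpha> + 1) * t * ln (ln t)) * f t) = X t / (\<sigma> * lil_scale t)" for t
  proof -
    have "sqrt (2 * inverse (2 * \<alpha> + 1) * t * ln (ln t)) = sqrt (inverse (2 * \<alpha> + 1) * (2 * t * ln (ln t)))"
      by (simp add: mult_ac)
    also have "\<dots> = \<sigma> * lil_scale t"
      unfolding real_sqrt_mult lil_scale_def \<sigma>_def by (simp add: real_sqrt_divide inverse_eq_divide)
    finally show ?thesis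
      by (simp add: X_def)
  qed
  have approx: "\<forall>\<^sub>F n in sequentially. \<forall>\<^sub>F t in at_top.
      \<bar>X t - weighted_increments \<alpha> n b t\<bar> \<le> \<epsilon> * lil_scale t" if "0 < \<epsilon>" for \<epsilon>
    using path that assms unfolding X_def lil_path_def by (intro convolution_approximation) auto
  have upper: "\<forall>\<^sub>F t in at_top. \<bar>X t / (\<sigma> * lil_scale t)\<bar> \<le> 1 + \<epsilon>" if "0 < \<epsilon>" for \<epsilon>
  proof -
    have \<epsilon>: "0 < \<epsilon> * \<sigma> / 2"
      using that \<open>0 < \<sigma>\<close> by simp
    obtain n where n: "\<forall>\<^sub>F t in at_top. \<bar>X t - weighted_increments \<alpha> n b t\<bar> \<le> \<epsilon> * \<sigma> / 2 * lil_scale t"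
        "\<forall>\<^sub>F t in at_top. \<bar>weighted_increments \<alpha> n b t\<bar> \<le> (\<sigma> + \<epsilon> * \<sigma> / 2) * lil_scale t"
      using eventually_conj[OF approx[OF \<epsilon>] lil_path_weighted_increments_le[OF path \<open>0 < \<alpha>\<close> \<epsilon>]]
      unfolding \<sigma>_def eventually_sequentially by blast
    from n eventually_lil_scale_pos show ?thesis
    proof eventually_elim
      case (elim t)
      then have "\<bar>X t\<bar> \<le> \<epsilon> * \<sigma> / 2 * lil_scale t + (\<sigma> + \<epsilon> * \<sigma> / 2) * lil_scale t"
        by linarith
      then have "\<bar>X t\<bar> \<le> (1 + \<epsilon>) * (\<sigma> * lil_scale t)"
        by (simp add: algebra_simps)
      then show ?case
        using elim \<open>0 < \<sigma>\<close> by (simp add: abs_mult pos_divide_le_eq)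
    qed
  qed
  have lower: "\<exists>\<^sub>F t in at_top. \<bar>X t / (\<sigma> * lil_scale t) - y\<bar> \<le> \<epsilon>" if y: "\<bar>y\<bar> \<le> 1" and "0 < \<epsilon>" for y \<epsilon>
  proof -
    \<comment> \<open>The \<open>min\<close> ensures \<open>\<eta> < \<sigma>\<close>, as exact hits
      require. The total error is \<open>2 * \<eta>\<close>: one \<open>\<eta>\<close> for the
      convolution, one for shrinking the target.\<close>
    define \<eta> where "\<eta> = min \<epsilon> 1 * \<sigma> / 2"
    have \<eta>: "0 < \<eta>" "\<eta> < \<sigma>" "2 * \<eta> \<le> \<epsilon> * \<sigma>"
      using \<open>0 < \<epsilon>\<close> \<open>0 < \<sigma>\<close> by (auto simp: \<eta>_def min_def)
    \<comment> \<open>The factor \<open>\<sigma> - \<eta>\<close> instead of \<open>\<sigma>\<close>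
      keeps even the endpoints \<open>y = 1\<close> and \<open>y = -1\<close> inside the attained
      range.\<close>
    define v where "v = y * (\<sigma> - \<eta>)"
    have "\<bar>v\<bar> \<le> \<sigma> - \<eta>"
      using y \<eta> by (simp add: v_def abs_mult mult_left_le_one_le)
    have v_near: "\<bar>v - y * \<sigma>\<bar> \<le> \<eta>"
      using y \<eta> by (simp add: v_def algebra_simps abs_mult mult_left_le)
    obtain n where n: "\<forall>\<^sub>F t in at_top. \<bar>X t - weighted_increments \<alpha> n b t\<bar> \<le> \<eta> * lil_scale t"
        "\<exists>\<^sub>F t in at_top. weighted_increments \<alpha> n b t = v * lil_scale t"
      using eventually_conj[OF approx[OF \<eta>(1)]
          lil_path_weighted_increments_hits[OF path \<open>0 < \<alpha>\<close> \<eta>(1) \<eta>(2)[unfolded \<sigma>_def]]] \<open>\<bar>v\<bar> \<le> \<sigma> - \<eta>\<close>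
      unfolding \<sigma>_def eventually_sequentially by blast
    from frequently_eventually_frequently[OF n(2) eventually_conj[OF n(1) eventually_lil_scale_pos]]
    show ?thesis
    proof (rule frequently_elim1)
      fix t
      assume *: "weighted_increments \<alpha> n b t = v * lil_scale t \<and>
        \<bar>X t - weighted_increments \<alpha> n b t\<bar> \<le> \<eta> * lil_scale t \<and> 0 < lil_scale t"
      have "\<bar>v * lil_scale t - y * \<sigma> * lil_scale t\<bar> = \<bar>v - y * \<sigma>\<bar> * lil_scale t"
        using * by (simp add: abs_mult flip: left_diff_distrib)
      also have "\<dots> \<le> \<eta> * lil_scale t"
        using * v_near by (intro mult_right_mono) auto
      finally have "\<bar>X t - y * \<sigma> * lil_scale t\<bar> \<le> 2 * \<eta> * lil_scale t"
        using * by linarith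
      also have "\<dots> \<le> \<epsilon> * \<sigma> * lil_scale t"
        using * \<eta> by (intro mult_right_mono) auto
      finally have "\<bar>X t - y * (\<sigma> * lil_scale t)\<bar> / (\<sigma> * lil_scale t) \<le> \<epsilon>"
        using * \<open>0 < \<sigma>\<close> by (simp add: pos_divide_le_eq mult.assoc)
      moreover have "X t / (\<sigma> * lil_scale t) - y = (X t - y * (\<sigma> * lil_scale t)) / (\<sigma> * lil_scale t)"
        using * \<open>0 < \<sigma>\<close> by (simp add: diff_divide_distrib)
      ultimately show "\<bar>X t / (\<sigma> * lil_scale t) - y\<bar> \<le> \<epsilon>"
        using * \<open>0 < \<sigma>\<close> by (simp add: abs_mult)
    qed
  qed
  show ?thesis
    unfolding ratio
  proof (intro equalityI subsetI)
    fix y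
    assume "y \<in> limit_points {a<..} (\<lambda>t. X t / (\<sigma> * lil_scale t))"
    then have "\<bar>y\<bar> \<le> 1 + \<epsilon>" if "0 < \<epsilon>" for \<epsilon>
      using upper[OF that] by (rule limit_point_abs_le)
    then have "\<bar>y\<bar> \<le> 1"
      by (rule field_le_epsilon)
    then show "y \<in> {-1..1}"
      by auto
  next
    fix y :: real
    assume "y \<in> {-1..1}"
    then show "y \<in> limit_points {a<..} (\<lambda>t. X t / (\<sigma> * lil_scale t))"
      by (intro limit_pointI lower) auto
  qed
qed

text \<open>The exceptional null set comes from \<open>lil_path\<close>, hence depends on
  \<open>\<alpha>\<close> and \<open>B\<close> but not on \<open>f\<close> or
  \<open>t0\<close>.\<close>

theorem proposition2p4:
  fixes M :: "'a measure" and B :: "real \<Rightarrow> 'a \<Rightarrow> real"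
    and f f' :: "real \<Rightarrow> real" and \<alpha> t0 :: real
  assumes "\<alpha> > 0"
    and "\<And>x. 0 \<le> x \<Longrightarrow> 0 \<le> f x"
    and "\<And>x. 0 \<le> x \<Longrightarrow> (f has_real_derivative f' x) (at x within {0..})"
    and "regularly_varying f' (\<alpha> - 1)"
    and "\<And>t. 0 \<le> t \<Longrightarrow> set_integrable lborel {0..t} f'"
    and "standard_brownian_motion M B"
    and "t0 > 0"
    and "\<And>t. t0 \<le> t \<Longrightarrow> f t > 0"
  shows "AE \<omega> in M.
    limit_points {max (exp 1) t0<..}
      (\<lambda>t. (LINT x:{0..t}|lborel. B (t - x) \<omega> * f' x) /
            (sqrt (2 * inverse (2 * \<alpha> + 1) * t * ln (ln t)) * f t)) = {-1..1}"
  using standard_brownian_motion.lil_path_AE[OF assms(6), of \<alpha>]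
  by eventually_elim (rule lil_path_limit_points[OF assms(1,3,4,5)])

end
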